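(* Let $0<s<\frac12$ and $\Lambda\in\mathbb{N}$, $\Lambda\ge 1$. Then the set of critical points of the energy $\mathcal{E}^s$ in $\mathcal{R}^\Lambda$ (i.e. the set of $X\in\mathcal{R}^\Lambda$ with $\nabla\mathcal{E}^s(X)=0$) is $\mathcal{C}^\Lambda$. Moreover, $\mathcal{C}^\Lambda$ coincides with the set of all local minimizers of $\mathcal{E}^s$ in $\mathcal{X}^\Lambda$, and with the set of all global minimizers of $\mathcal{E}^s$ in $\mathcal{X}^\Lambda$.
   Context: Let $\mathcal{X}^\Lambda:=[0,\Lambda)^\Lambda$; entries of $X=(x_1,\dots,x_\Lambda)\in\mathcal{X}^\Lambda$ need not be distinct. Let $\mathcal{S}(X):=\{x_1,\dots,x_\Lambda\}\subset[0,\Lambda)$ be the set of values of the entries, and let $\mathcal{R}^\Lambda$ be the set of regular configurations, i.e. of those $X\in\mathcal{X}^\Lambda$ with pairwise distinct entries. Let $\mathcal{C}^\Lambda:=\{X\in\mathcal{R}^\Lambda:\ \mathcal{S}(X)=\{\tau,1+\tau,\dots,\Lambda-1+\tau\}\text{ for some }\tau\in[0,1)\}$. Let $\mu^X:=\sum_{\lambda=1}^{\Lambda}\sum_{k\in\mathbb{Z}}\delta_{x_\lambda+\Lambda k}$, and let $u^X\in BV_{\rm loc}(\mathbb{R})$ be the function, unique up to additive constants and $\Lambda$-periodic, whose distributional derivative is $(u^X)'=\mathrm{d}x-\mu^X$. For $0<s<\frac12$, $$\mathcal{E}^s(X):=\frac12\int_0^\Lambda \mathrm{d}x\int_{\mathbb{R}}\frac{|u^X(x)-u^X(y)|^2}{|x-y|^{1+2s}}\,\mathrm{d}y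 .$$ Since $\mathcal{E}^s$ depends on $X$ only through $\mu^X$, positions are read modulo $\Lambda$: $\mathcal{X}^\Lambda$ is identified with the torus $(\mathbb{R}/\Lambda\mathbb{Z})^\Lambda$, and local minimality and the gradient $\nabla\mathcal{E}^s$ with respect to $(x_1,\dots,x_\Lambda)$ are understood there. *)

theory Defs
  imports "HOL-Analysis.Analysis"
begin

text \<open>
  A configuration is a vector \<open>X :: real ^ 'n\<close>; the number of points, which is also the period
  (called $\Lambda$ in the mathematical text), is \<open>CARD('n)\<close>, so it is arbitrary and at least 1.
  The measure, the function \<open>u\<close> and the energy are defined for arbitrary real positions. They
  depend only on the positions modulo the period, so the energy on \<open>real ^ 'n\<close> is the lift of the
  energy on the torus.
\<close>

definition configs :: "(real ^ 'n) set" where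
  "configs = {X. \<forall>i. X $ i \<in> {0..<real CARD('n)}}"

definition vals :: "real ^ 'n \<Rightarrow> real set" where
  "vals X = range (\<lambda>i. X $ i)"

definition regular_configs :: "(real ^ 'n) set" where
  "regular_configs = {X \<in> configs. inj (\<lambda>i. X $ i)}"

definition equispaced_configs :: "(real ^ 'n) set" where
  "equispaced_configs =
     {X \<in> regular_configs. \<exists>\<tau>\<in>{0..<1}. vals X = (\<lambda>j. real j + \<tau>) ` {0..<CARD('n)}}"

text \<open>
  The sum of Dirac masses at all \<open>X $ i + k * CARD('n)\<close>, counted with multiplicity, written as the
  image of a counting measure.
\<close>

definition point_measure_per :: "real ^ 'n \<Rightarrow> real measure" where
  "point_measure_per X =
     distr (count_space (UNIV :: ('n \<times> int) set)) borel
       (\<lambda>(i, k). X $ i + real CARD('n) * of_int k)"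

definition test_function :: "(real \<Rightarrow> real) \<Rightarrow> bool" where
  "test_function \<phi> \<longleftrightarrow>
     (\<forall>m x. (deriv ^^ m) \<phi> field_differentiable at x) \<and>
     (\<exists>a b. \<forall>x. x \<notin> {a..b} \<longrightarrow> \<phi> x = 0)"

definition locally_integrable :: "(real \<Rightarrow> real) \<Rightarrow> bool" where
  "locally_integrable u \<longleftrightarrow> (\<forall>a b. set_integrable lborel {a..b} u)"

text \<open>The variation of \<open>u\<close> on bounded open intervals is finite.\<close>

definition BV_loc :: "(real \<Rightarrow> real) \<Rightarrow> bool" where
  "BV_loc u \<longleftrightarrow> locally_integrable u \<and>
     (\<forall>a b. \<exists>C. \<forall>\<phi>. test_function \<phi> \<longrightarrow> (\<forall>x. \<bar>\<phi> x\<bar> \<le> 1) \<longrightarrow>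
        closure {x. \<phi> x \<noteq> 0} \<subseteq> {a<..<b} \<longrightarrow>
        (\<integral>x. u x * deriv \<phi> x \<partial>lborel) \<le> C)"

text \<open>The distributional derivative of \<open>u\<close> is the difference of the two locally finite measures.\<close>

definition has_distributional_deriv ::
    "(real \<Rightarrow> real) \<Rightarrow> real measure \<Rightarrow> real measure \<Rightarrow> bool" where
  "has_distributional_deriv u M N \<longleftrightarrow>
     (\<forall>\<phi>. test_function \<phi> \<longrightarrow>
        - (\<integral>x. u x * deriv \<phi> x \<partial>lborel) = (\<integral>x. \<phi> x \<partial>M) - (\<integral>x. \<phi> x \<partial>N))"

text \<open>
  Such a function exists and is unique up to an additive constant and modification on a null set;
  neither affects the energy, so the choice is immaterial.
\<close>

definition u_of :: "real ^ 'n \<Rightarrow> real \<Rightarrow> real" where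
  "u_of X = (SOME u. BV_loc u \<and> (\<forall>x. u (x + real CARD('n)) = u x) \<and>
     has_distributional_deriv u lborel (point_measure_per X))"

definition energy :: "real \<Rightarrow> real ^ 'n \<Rightarrow> ennreal" where
  "energy s X = ennreal (1 / 2) *
     (\<integral>\<^sup>+x\<in>{0..real CARD('n)}.
        (\<integral>\<^sup>+y. ennreal (\<bar>u_of X x - u_of X y\<bar>\<^sup>2 / \<bar>x - y\<bar> powr (1 + 2 * s)) \<partial>lborel) \<partial>lborel)"

text \<open>
  For \<open>0 < s < 1/2\<close> the energy is finite, so \<open>enn2real\<close> loses nothing. The gradient is taken in
  \<open>real ^ 'n\<close>, which is the local chart of the torus at \<open>X\<close>; in particular there is no boundary
  effect at positions equal to 0.
\<close>

definition critical_point :: "real \<Rightarrow> real ^ 'n \<Rightarrow> bool" where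
  "critical_point s X \<longleftrightarrow> GDERIV (\<lambda>Y. enn2real (energy s Y)) X :> 0"

text \<open>Neighbourhoods of \<open>X\<close> are those of the torus: each position is close modulo the period.\<close>

definition local_minimizer :: "real \<Rightarrow> real ^ 'n \<Rightarrow> bool" where
  "local_minimizer s X \<longleftrightarrow> X \<in> configs \<and>
     (\<exists>\<epsilon>>0. \<forall>Y\<in>configs.
        (\<forall>i. \<exists>k::int. \<bar>Y $ i - X $ i - real CARD('n) * of_int k\<bar> < \<epsilon>) \<longrightarrow>
        energy s X \<le> energy s Y)"

definition global_minimizer :: "real \<Rightarrow> real ^ 'n \<Rightarrow> bool" where
  "global_minimizer s X \<longleftrightarrow> X \<in> configs \<and> (\<forall>Y\<in>(configs :: (real ^ 'n) set). energy s X \<le> energy s Y)"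

end

theory Submission
  imports Defs
begin

text \<open>
  The function $u^X$ is, up to a constant, a sum of sawtooth functions of period $\Lambda$ with
  downward jumps at the points $x_i$. Expanding the square in the energy and integrating over one
  period first gives $\mathcal{E}^s(X) = \sum_{i,j} K(x_i - x_j)$, where $K$ is the integral over
  \<open>h\<close> of $\frac12 |h|^{-1-2s}$ times the second difference of the autocorrelation of the sawtooth.
  As a function of the distance this second difference is a tent supported near the multiples of
  $\Lambda$ plus a constant, so \<open>K\<close> is even, periodic and strictly convex on $[0,\Lambda]$.

  Number the points in cyclic order. For every \<open>m\<close> the differences $x_{k+m} - x_k$ lie in
  $[0,\Lambda]$ and sum to $m\Lambda$, so by Jensen their total energy is minimal when they all equal
  \<open>m\<close>, and for \<open>m = 1\<close> only then. Along the segment from \<open>X\<close> to an equispaced configuration in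
  the same cyclic order the energy lies below its chord, so local minimizers and critical points are
  global minimizers.
\<close>

section \<open>The autocorrelation of the sawtooth\<close>

text \<open>The function \<open>u_of X\<close> is an arbitrary choice among functions with a
  prescribed distributional derivative, so its sawtooth form has to be earned: a locally integrable
  function with zero distributional derivative is shown to be almost everywhere constant, because
  its integrals over intervals depend only on the length. The range of \<open>s\<close> enters
  through one bound, \<open>min L \<bar>h\<bar>\<close> for the tent. Its quotient by
  \<open>\<bar>h\<bar> powr (1 + 2 * s)\<close> is integrable near 0 because
  \<open>s < 1 / 2\<close>, and at infinity because \<open>s > 0\<close>. The kernel is convex only
  inside one period and has its maximum at the multiples of the period. A straight segment between
  two arbitrary configurations therefore proves nothing. Keeping the cyclic order confines every
  difference to a single period along the segment, and there convexity applies.\<close>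

definition sawcorr :: "real \<Rightarrow> real" where
  "sawcorr t = 1 / 3 - frac t * (1 - frac t) / 2"

lemma sawcorr_cong: "frac s = frac t \<Longrightarrow> sawcorr s = sawcorr t"
  by (simp add: sawcorr_def)

lemma frac_add_int: "frac (t + of_int k) = frac t" for t :: real
  by (simp add: frac_def)

lemma sawcorr_minus: "sawcorr (- t) = sawcorr t"
  by (simp add: sawcorr_def frac_neg)

lemma sawcorr_eq: "0 \<le> a \<Longrightarrow> a \<le> 1 \<Longrightarrow> sawcorr a = 1 / 3 - a * (1 - a) / 2"
  by (cases "a = 1") (auto simp: sawcorr_def frac_eq[THEN iffD2])

lemma sawcorr_eq_plus: "1 \<le> a \<Longrightarrow> a \<le> 2 \<Longrightarrow> sawcorr a = 1 / 3 - (a - 1) * (2 - a) / 2"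
  using sawcorr_eq[of "a - 1"] sawcorr_cong[of a "a - 1"] frac_add_int[of "a - 1" 1] by simp

text \<open>This is the origin of the formula for \<open>sawcorr\<close>. The second factor jumps at
  \<open>f = frac a\<close>: it is \<open>t - f + 1\<close> before and \<open>t - f\<close> after,
  so both pieces integrate as polynomials, up to one endpoint each.\<close>

lemma has_integral_sawcorr:
  "((\<lambda>t. frac t * frac (t - a)) has_integral sawcorr a) {0..1}"
proof -
  define f where "f = frac a"
  have f: "0 \<le> f" "f < 1" by (auto simp: f_def frac_ge_0 frac_lt_1)
  have fr: "frac (t - a) = frac (t - f)" for t
    using frac_add_int[of "t - a" "floor a"] by (simp add: f_def frac_def algebra_simps)
  have 1: "((\<lambda>t. t * (t - f + 1)) has_integral
        ((f^3 / 3 - f * f^2 / 2 + f^2 / 2) - (0^3 / 3 - f * 0^2 / 2 + 0^2 / 2))) {0..f}"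
    using f by (intro fundamental_theorem_of_calculus)
      (auto intro!: derivative_eq_intros simp flip: has_real_derivative_iff_has_vector_derivative
        simp: field_simps power2_eq_square)
  have 2: "((\<lambda>t. t * (t - f)) has_integral
        ((1^3 / 3 - f * 1^2 / 2) - (f^3 / 3 - f * f^2 / 2))) {f..1}"
    using f by (intro fundamental_theorem_of_calculus)
      (auto intro!: derivative_eq_intros simp flip: has_real_derivative_iff_has_vector_derivative
        simp: field_simps power2_eq_square)
  have 3: "((\<lambda>t. frac t * frac (t - a)) has_integral
        ((f^3 / 3 - f * f^2 / 2 + f^2 / 2) - (0^3 / 3 - f * 0^2 / 2 + 0^2 / 2))) {0..f}"
  proof (rule has_integral_spike_finite[OF _ _ 1, of "{f}"])
    fix t assume t: "t \<in> {0..f} - {f}"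
    then have "frac t = t" "frac (t - f) = frac (t - f + 1)"
      using f frac_add_int[of "t - f" 1] by (auto simp: frac_eq)
    moreover have "frac (t - f + 1) = t - f + 1" using t f by (auto simp: frac_eq)
    ultimately show "frac t * frac (t - a) = t * (t - f + 1)" unfolding fr by simp
  qed auto
  have 4: "((\<lambda>t. frac t * frac (t - a)) has_integral
        ((1^3 / 3 - f * 1^2 / 2) - (f^3 / 3 - f * f^2 / 2))) {f..1}"
  proof (rule has_integral_spike_finite[OF _ _ 2, of "{1}"])
    fix t assume t: "t \<in> {f..1} - {1}"
    then have "frac t = t" "frac (t - f) = t - f" using f by (auto simp: frac_eq)
    then show "frac t * frac (t - a) = t * (t - f)" unfolding fr by simp
  qed auto
  have "sawcorr a = ((f^3 / 3 - f * f^2 / 2 + f^2 / 2) - (0^3 / 3 - f * 0^2 / 2 + 0^2 / 2))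
      + ((1^3 / 3 - f * 1^2 / 2) - (f^3 / 3 - f * f^2 / 2))"
    unfolding sawcorr_def f_def[symmetric] by (simp add: field_simps power2_eq_square)
  then show ?thesis using has_integral_combine[OF _ _ 3 4] f by simp
qed

text \<open>The part of the unit period after \<open>frac c\<close> is moved by
  \<open>floor c\<close>, the part before it by \<open>floor c + 1\<close>; together they tile
  \<open>{c..c + 1}\<close>.\<close>

lemma has_integral_periodic_shift:
  fixes f :: "real \<Rightarrow> real"
  assumes per: "\<And>x. f (x + 1) = f x" and I: "(f has_integral I) {0..1}"
  shows "(f has_integral I) {c..c + 1}"
proof -
  have pern: "f (x + of_nat n) = f x" for x n
  proof (induction n)
    case (Suc n)
    have "f (x + of_nat (Suc n)) = f ((x + of_nat n) + 1)" by (simp add: algebra_simps)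
    with Suc show ?case by (simp only: per)
  qed simp
  have peri: "f (x + of_int k) = f x" for x k
  proof (cases "k \<ge> 0")
    case True then show ?thesis using pern[of x "nat k"] by simp
  next
    case False then show ?thesis using pern[of "x + of_int k" "nat (- k)"] by simp
  qed
  define r where "r = frac c"
  have r: "0 \<le> r" "r \<le> 1" "c = r + of_int (floor c)"
    using frac_lt_1[of c] by (auto simp: r_def frac_ge_0 less_imp_le) (simp add: frac_def)
  have i1: "f integrable_on {0..r}" and i2: "f integrable_on {r..1}"
    using I r integrable_subinterval_real[of f 0 1] by (auto simp: has_integral_integrable)
  have s: "integral {0..r} f + integral {r..1} f = I"
    using Henstock_Kurzweil_Integration.integral_combine[OF r(1,2)] I by (auto simp: has_integral_iff)
  have sh: "(f has_integral J) {a + of_int k..b + of_int k}" if "(f has_integral J) {a..b}"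
    for J a b and k :: int
  proof -
    have "((\<lambda>x. f (x + - of_int k)) has_integral J) (((+) (of_int k)) ` {a..b})"
      using has_integral_affinity[OF that[unfolded cbox_interval[symmetric]], of 1 "- of_int k"]
      by (simp add: image_image add.commute)
    then show ?thesis using peri[of _ "-k"] by (simp add: add.commute)
  qed
  have "(f has_integral integral {r..1} f) {r + of_int (floor c)..1 + of_int (floor c)}"
    by (rule sh) (use i2 in auto)
  moreover have "(f has_integral integral {0..r} f) {0 + of_int (floor c + 1)..r + of_int (floor c + 1)}"
    by (rule sh) (use i1 in auto)
  ultimately have "(f has_integral integral {r..1} f + integral {0..r} f) {c..c+1}"
    using r by (intro has_integral_combine[of c "1 + of_int (floor c)" "c + 1"]) (auto simp: algebra_simps)
  with s show ?thesis by (simp add: add.commute)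
qed

text \<open>Rescaling by \<open>L\<close> and centring at \<open>p\<close> turns
  \<open>{0..L}\<close> into the unit interval starting at \<open>- p / L\<close>, hence the need
  for periods that start anywhere.\<close>

lemma has_integral_sawtooth_product:
  fixes L :: real
  assumes L: "L > 0"
  shows "((\<lambda>x. frac ((x - p) / L) * frac ((x - q) / L)) has_integral L * sawcorr ((p - q) / L)) {0..L}"
proof -
  define g where "g t = frac t * frac (t - (q - p) / L)" for t
  have "g (t + 1) = g t" for t
    using frac_add_int[of t 1] frac_add_int[of "t - (q - p) / L" 1] by (simp add: g_def algebra_simps)
  moreover have "(g has_integral sawcorr ((q - p) / L)) {0..1}"
    unfolding g_def by (rule has_integral_sawcorr)
  ultimately have "(g has_integral sawcorr ((q - p) / L)) {- p / L..- p / L + 1}"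
    by (rule has_integral_periodic_shift)
  from has_integral_affinity[OF this[unfolded cbox_interval[symmetric]], of "1 / L" "- p / L"]
  have "((\<lambda>x. g (x / L - p / L)) has_integral L * sawcorr ((q - p) / L))
     ((\<lambda>x. L * x + p) ` {- p / L..- p / L + 1})"
    using L by simp
  moreover have "(\<lambda>x. L * x + p) ` {- p / L..- p / L + 1} = {0..L}"
    using L by (subst image_affinity_atLeastAtMost) (auto simp: algebra_simps)
  moreover have "g (x / L - p / L) = frac ((x - p) / L) * frac ((x - q) / L)" for x
    by (simp add: g_def field_simps diff_divide_distrib)
  moreover have "sawcorr ((q - p) / L) = sawcorr ((p - q) / L)"
    using sawcorr_minus[of "(p - q) / L"] by (simp add: minus_divide_left)
  ultimately show ?thesis by simp
qed

text \<open>A tent function on the circle, hence convex away from its kink at 0.\<close>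

lemma sawcorr_second_difference:
  assumes "0 \<le> a" "a \<le> 1" "0 \<le> b" "b \<le> 1"
  shows "2 * sawcorr a - sawcorr (a + b) - sawcorr (a - b) = max 0 (b - a) + max 0 (b + a - 1) - b\<^sup>2"
proof -
  have "sawcorr (a + b) = (if a + b \<le> 1 then 1 / 3 - (a + b) * (1 - (a + b)) / 2
      else 1 / 3 - (a + b - 1) * (2 - (a + b)) / 2)"
    using assms by (auto simp: sawcorr_eq sawcorr_eq_plus)
  moreover have "sawcorr (a - b) = (if b \<le> a then 1 / 3 - (a - b) * (1 - (a - b)) / 2
      else 1 / 3 - (b - a) * (1 - (b - a)) / 2)"
    using assms sawcorr_minus[of "a - b"] by (auto simp: sawcorr_eq)
  moreover have "max 0 (b - a) = (if b \<le> a then 0 else b - a)"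
    and "max 0 (b + a - 1) = (if a + b \<le> 1 then 0 else b + a - 1)"
    by auto
  moreover have "sawcorr a = 1 / 3 - a * (1 - a) / 2"
    using assms by (simp add: sawcorr_eq)
  ultimately show ?thesis
    by (cases "b \<le> a"; cases "a + b \<le> 1") (simp_all, simp_all add: field_simps power2_eq_square)
qed

text \<open>The integral over one period of the product of the increments by \<open>h\<close> of two
  sawtooths whose jumps are \<open>d\<close> apart. The factor \<open>L\<close> comes from rescaling
  to the unit period.\<close>

definition tent :: "real \<Rightarrow> real \<Rightarrow> real \<Rightarrow> real" where
  "tent L h d = L * (2 * sawcorr (d / L) - sawcorr ((d + h) / L) - sawcorr ((d - h) / L))"

lemma tent_minus_left: "tent L (- h) d = tent L h d"
  by (simp add: tent_def)

lemma tent_abs_left: "tent L \<bar>h\<bar> d = tent L h d"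
  by (cases "h \<ge> 0") (auto simp: tent_minus_left)

lemma tent_minus: "tent L h (- d) = tent L h d"
proof -
  have "- d / L = - (d / L)" "(- d + h) / L = - ((d - h) / L)" "(- d - h) / L = - ((d + h) / L)"
    by (simp_all add: field_simps diff_divide_distrib add_divide_distrib)
  then show ?thesis by (simp only: tent_def sawcorr_minus) simp
qed

lemma tent_periodic:
  assumes "L > 0" shows "tent L h (d + L * of_int k) = tent L h d"
proof -
  have "sawcorr ((e + L * of_int k) / L) = sawcorr (e / L)" for e
    using assms frac_add_int[of "e / L" k] by (intro sawcorr_cong) (simp add: add_divide_distrib)
  from this[of d] this[of "d + h"] this[of "d - h"] show ?thesis
    by (simp add: tent_def algebra_simps)
qed

text \<open>Evenness and periodicity in \<open>h\<close> reduce \<open>h / L\<close> to its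
  fractional part \<open>b\<close>. As a function of \<open>d\<close> there remain two hinges, with
  kinks at \<open>L * b\<close> and \<open>L * (1 - b)\<close>, and a constant; convexity and the
  difference estimates are read off from this form.\<close>

lemma tent_eq:
  assumes L: "L > 0" and d: "0 \<le> d" "d \<le> L"
  shows "tent L h d = L * (max 0 (frac (\<bar>h\<bar> / L) - d / L) + max 0 (frac (\<bar>h\<bar> / L) + d / L - 1)
    - (frac (\<bar>h\<bar> / L))\<^sup>2)"
proof -
  define b where "b = frac (\<bar>h\<bar> / L)"
  have b: "0 \<le> b" "b \<le> 1" by (auto simp: b_def frac_ge_0 frac_lt_1 less_imp_le)
  have e: "\<bar>h\<bar> / L = b + of_int (floor (\<bar>h\<bar> / L))" by (simp add: b_def frac_def)
  have "sawcorr ((d + \<bar>h\<bar>) / L) = sawcorr (d / L + b)"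
  proof (rule sawcorr_cong)
    have "(d + \<bar>h\<bar>) / L = d / L + b + of_int (floor (\<bar>h\<bar> / L))"
      using e by (simp add: add_divide_distrib)
    then show "frac ((d + \<bar>h\<bar>) / L) = frac (d / L + b)" by (simp only: frac_add_int)
  qed
  moreover have "sawcorr ((d - \<bar>h\<bar>) / L) = sawcorr (d / L - b)"
  proof (rule sawcorr_cong)
    have "d / L - b = (d - \<bar>h\<bar>) / L + of_int (floor (\<bar>h\<bar> / L))"
      using e by (simp add: diff_divide_distrib)
    then show "frac ((d - \<bar>h\<bar>) / L) = frac (d / L - b)" by (simp only: frac_add_int)
  qed
  ultimately have "tent L \<bar>h\<bar> d = L * (2 * sawcorr (d / L) - sawcorr (d / L + b) - sawcorr (d / L - b))"
    by (simp add: tent_def)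
  also have "\<dots> = L * (max 0 (b - d / L) + max 0 (b + d / L - 1) - b\<^sup>2)"
    using L d b by (subst sawcorr_second_difference) auto
  finally show ?thesis by (simp add: tent_abs_left b_def)
qed

lemma frac_le_self: "0 \<le> x \<Longrightarrow> frac x \<le> x" for x :: real
  by (simp add: frac_def)

lemma ex_shift_interval:
  fixes L :: real assumes "L > 0"
  obtains k :: int where "0 \<le> d + L * of_int k" "d + L * of_int k < L"
proof (rule that[of "- floor (d / L)"])
  have "d + L * of_int (- floor (d / L)) = L * frac (d / L)"
    using assms by (simp add: frac_def field_simps)
  then show "0 \<le> d + L * of_int (- floor (d / L))" "d + L * of_int (- floor (d / L)) < L"
    using assms frac_lt_1[of "d / L"] by (auto simp: frac_ge_0)
qed

text \<open>The bound \<open>\<bar>h\<bar>\<close> tames the singularity of the weight at 0, the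
  bound \<open>L\<close> serves at infinity. Both come from \<open>b \<le> \<bar>h\<bar> / L\<close>
  and \<open>b \<le> 1\<close>, since the two hinges together, like the square of \<open>b\<close>,
  lie between 0 and \<open>b\<close>.\<close>

lemma tent_bound:
  assumes L: "L > 0" shows "\<bar>tent L h d\<bar> \<le> min L \<bar>h\<bar>"
proof -
  obtain k :: int where k: "0 \<le> d + L * of_int k" "d + L * of_int k < L"
    using ex_shift_interval[OF L] by blast
  define a where "a = (d + L * of_int k) / L"
  define b where "b = frac (\<bar>h\<bar> / L)"
  have b: "0 \<le> b" "b \<le> 1" "b \<le> \<bar>h\<bar> / L" using L
    by (auto simp: b_def frac_ge_0 frac_lt_1 less_imp_le frac_le_self)
  have a: "0 \<le> a" "a \<le> 1" using k L by (auto simp: a_def)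
  have e: "tent L h d = L * (max 0 (b - a) + max 0 (b + a - 1) - b\<^sup>2)"
    using tent_eq[OF L k(1) less_imp_le[OF k(2)], of h] tent_periodic[OF L, of h d k] by (simp add: a_def b_def)
  have "b\<^sup>2 \<le> b" using b by (simp add: power2_eq_square mult_left_le)
  moreover have "0 \<le> b\<^sup>2" by simp
  moreover have "max 0 (b - a) + max 0 (b + a - 1) \<le> b" "0 \<le> max 0 (b - a) + max 0 (b + a - 1)"
    using a b by (auto simp: max_def)
  ultimately have "\<bar>max 0 (b - a) + max 0 (b + a - 1) - b\<^sup>2\<bar> \<le> b" by linarith
  then have "\<bar>tent L h d\<bar> \<le> L * b" using L by (simp add: e abs_mult)
  moreover have "L * b \<le> L" "L * b \<le> \<bar>h\<bar>" using b L by (auto simp: field_simps)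
  ultimately show ?thesis by linarith
qed

lemma frac_measurable [measurable]: "(frac :: real \<Rightarrow> real) \<in> borel_measurable borel"
  unfolding frac_def by measurable

lemma tent_measurable [measurable]:
  "(\<lambda>h. tent L h d) \<in> borel_measurable borel"
  unfolding tent_def sawcorr_def by measurable

section \<open>The interaction kernel\<close>

lemma max_zero_convex:
  fixes u v p q :: real
  assumes "0 \<le> u" "0 \<le> v"
  shows "max 0 (u * p + v * q) \<le> u * max 0 p + v * max 0 q"
proof -
  have "u * p \<le> u * max 0 p" "v * q \<le> v * max 0 q"
    using assms by (auto intro: mult_left_mono)
  moreover have "0 \<le> u * max 0 p" "0 \<le> v * max 0 q"
    using assms by auto
  ultimately show ?thesis by linarith
qed

lemma convex_on_tent:
  assumes L: "L > 0" shows "convex_on {0..L} (tent L h)"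
proof (rule convex_onI)
  fix t x y :: real
  assume t: "0 < t" "t < 1" and x: "x \<in> {0..L}" and y: "y \<in> {0..L}"
  define b where "b = frac (\<bar>h\<bar> / L)"
  define z where "z = (1 - t) * x + t * y"
  have z: "z \<in> {0..L}"
    using convexD[OF convex_real_interval(5)[of 0 L] x y, of "1 - t" t] t by (simp add: z_def)
  have "b - z / L = (1 - t) * (b - x / L) + t * (b - y / L)"
    by (simp add: z_def algebra_simps add_divide_distrib diff_divide_distrib)
  then have 1: "max 0 (b - z / L) \<le> (1 - t) * max 0 (b - x / L) + t * max 0 (b - y / L)"
    using max_zero_convex[of "1 - t" t "b - x / L" "b - y / L"] t
    by simp
  have "b + z / L - 1 = (1 - t) * (b + x / L - 1) + t * (b + y / L - 1)"
    by (simp add: z_def algebra_simps add_divide_distrib diff_divide_distrib)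
  then have 2: "max 0 (b + z / L - 1) \<le> (1 - t) * max 0 (b + x / L - 1) + t * max 0 (b + y / L - 1)"
    using max_zero_convex[of "1 - t" t "b + x / L - 1" "b + y / L - 1"] t
    by simp
  have "max 0 (b - z / L) + max 0 (b + z / L - 1) - b\<^sup>2 \<le>
      (1 - t) * (max 0 (b - x / L) + max 0 (b + x / L - 1) - b\<^sup>2) +
      t * (max 0 (b - y / L) + max 0 (b + y / L - 1) - b\<^sup>2)"
    using 1 2 by (simp add: algebra_simps)
  then have "L * (max 0 (b - z / L) + max 0 (b + z / L - 1) - b\<^sup>2) \<le>
      L * ((1 - t) * (max 0 (b - x / L) + max 0 (b + x / L - 1) - b\<^sup>2) +
      t * (max 0 (b - y / L) + max 0 (b + y / L - 1) - b\<^sup>2))"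
    using L by (intro mult_left_mono) auto
  then have "tent L h z \<le> (1 - t) * tent L h x + t * tent L h y"
    using x y z L unfolding b_def by (simp add: tent_eq algebra_simps)
  then show "tent L h ((1 - t) *\<^sub>R x + t *\<^sub>R y) \<le> (1 - t) * tent L h x + t * tent L h y"
    by (simp add: z_def)
qed (rule convex_real_interval)

section \<open>Integrability against the singular weight\<close>

lemma integrable_indicator_powr_from_0:
  assumes "a > -1" shows "integrable lborel (\<lambda>h::real. indicator {0..1} h * h powr a)"
proof -
  have "(\<lambda>x. x powr a) integrable_on {0..1}"
    using has_integral_powr_from_0[OF assms, of 1] by (auto simp: has_integral_integrable)
  then have "set_integrable lebesgue {0..1} (\<lambda>x. x powr a)"
    by (intro nonnegative_absolutely_integrable_1) auto
  then show ?thesis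
    unfolding set_integrable_def by (subst (asm) integrable_completion) (auto)
qed

lemma integrable_indicator_powr_to_inf:
  assumes "a < -1" shows "integrable lborel (\<lambda>h::real. indicator {1..} h * h powr a)"
proof -
  have "(\<lambda>x. x powr a) integrable_on {1..}"
    using has_integral_powr_to_inf[OF assms, of 1] by (auto simp: has_integral_integrable)
  then have "set_integrable lebesgue {1..} (\<lambda>x. x powr a)"
    by (intro nonnegative_absolutely_integrable_1) auto
  then show ?thesis
    unfolding set_integrable_def by (subst (asm) integrable_completion) (auto)
qed

lemma integrable_reflect_real:
  fixes f :: "real \<Rightarrow> real"
  assumes "integrable lborel f" shows "integrable lborel (\<lambda>x. f (- x))"
  using lborel_integrable_real_affine[OF assms, of "-1" 0] by simp

text \<open>For \<open>h \<le> 1\<close> the quotient is at most \<open>h powr (- 2 * s)\<close>,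
  beyond 1 it is at most \<open>L * h powr (- 1 - 2 * s)\<close>. The majorant \<open>P\<close>
  lives on the positive half line; its reflection covers negative \<open>h\<close>.\<close>

lemma integrable_min_weight:
  fixes s L :: real
  assumes s: "0 < s" "s < 1 / 2" and L: "L > 0"
  shows "integrable lborel (\<lambda>h::real. min L \<bar>h\<bar> / \<bar>h\<bar> powr (1 + 2 * s))"
proof -
  define P where "P h = indicator {0..1} h * h powr (- 2 * s) + L * (indicator {1..} h * h powr (- 1 - 2 * s))"
    for h :: real
  have P: "integrable lborel P" unfolding P_def
    using s by (intro Bochner_Integration.integrable_add integrable_mult_right
      integrable_indicator_powr_from_0 integrable_indicator_powr_to_inf) auto
  have Pn: "P h \<ge> 0" for h using L by (auto simp: P_def)
  have *: "min L h / h powr (1 + 2 * s) \<le> P h" if h: "h > 0" for h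
  proof (cases "h \<le> 1")
    case True
    have "min L h / h powr (1 + 2 * s) \<le> h / h powr (1 + 2 * s)"
      by (intro divide_right_mono) auto
    also have "\<dots> = h powr (- 2 * s)"
      using h by (simp add: powr_add powr_minus field_simps)
    also have "\<dots> \<le> P h" using True h L by (auto simp: P_def)
    finally show ?thesis .
  next
    case False
    have "min L h / h powr (1 + 2 * s) \<le> L / h powr (1 + 2 * s)"
      by (intro divide_right_mono) auto
    also have "\<dots> = L * h powr (- 1 - 2 * s)"
      using h by (simp add: powr_add powr_minus powr_diff field_simps)
    also have "\<dots> \<le> P h" using False h L by (auto simp: P_def)
    finally show ?thesis .
  qed
  have b: "min L \<bar>h\<bar> / \<bar>h\<bar> powr (1 + 2 * s) \<le> P h + P (- h)" for h
    using *[of "\<bar>h\<bar>"] Pn[of h] Pn[of "- h"] L by (cases "h = 0"; cases "h > 0") auto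
  show ?thesis
    by (rule Bochner_Integration.integrable_bound[OF Bochner_Integration.integrable_add[OF P integrable_reflect_real[OF P]]])
      (use b Pn L in \<open>auto intro!: AE_I2 simp: abs_of_nonneg\<close>)
qed

section \<open>Convexity of the kernel\<close>

definition kernel :: "real \<Rightarrow> real \<Rightarrow> real \<Rightarrow> real" where
  "kernel s L d = (1 / 2) * (\<integral>h. tent L h d / \<bar>h\<bar> powr (1 + 2 * s) \<partial>lborel)"

lemma kernel_minus: "kernel s L (- d) = kernel s L d"
  by (simp add: kernel_def tent_minus)

lemma kernel_periodic: "L > 0 \<Longrightarrow> kernel s L (d + L * of_int k) = kernel s L d"
  by (simp add: kernel_def tent_periodic)

context
  fixes s L :: real
  assumes s: "0 < s" "s < 1 / 2" and L: "L > 0"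
begin

lemma integrable_kernel: "integrable lborel (\<lambda>h. tent L h d / \<bar>h\<bar> powr (1 + 2 * s))"
  by (rule Bochner_Integration.integrable_bound[OF integrable_min_weight[OF s L]])
    (use L tent_bound[OF L] in \<open>auto intro!: AE_I2 divide_right_mono simp: abs_of_nonneg\<close>)

lemma convex_on_kernel: "convex_on {0..L} (kernel s L)"
proof (rule convex_onI)
  fix t x y :: real
  assume t: "0 < t" "t < 1" and x: "x \<in> {0..L}" and y: "y \<in> {0..L}"
  let ?w = "\<lambda>h::real. \<bar>h\<bar> powr (1 + 2 * s)"
  let ?z = "(1 - t) *\<^sub>R x + t *\<^sub>R y"
  define g where "g d h = tent L h d / ?w h" for d h
  have gi: "integrable lborel (g d)" for d unfolding g_def by (rule integrable_kernel)
  have K: "kernel s L d = 1 / 2 * integral\<^sup>L lborel (g d)" for d by (simp add: kernel_def g_def[abs_def])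
  have "integral\<^sup>L lborel (g ?z) \<le> (\<integral>h. (1 - t) * g x h + t * g y h \<partial>lborel)"
  proof (rule integral_mono)
    fix h :: real
    have "tent L h ?z / ?w h \<le> ((1 - t) * tent L h x + t * tent L h y) / ?w h"
      using convex_onD[OF convex_on_tent[OF L, of h], of t x y] x y t
      by (intro divide_right_mono) auto
    then show "g ?z h \<le> (1 - t) * g x h + t * g y h"
      by (simp add: g_def add_divide_distrib)
  qed (use gi in auto)
  also have "\<dots> = (1 - t) * integral\<^sup>L lborel (g x) + t * integral\<^sup>L lborel (g y)"
    using gi by (subst Bochner_Integration.integral_add) auto
  finally show "kernel s L ?z \<le> (1 - t) * kernel s L x + t * kernel s L y"
    unfolding K by (simp add: field_simps)
qed (rule convex_real_interval)

text \<open>For \<open>a < h < c\<close> the first hinge has its kink at \<open>d = h\<close>,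
  strictly between \<open>a\<close> and \<open>c\<close>, so the midpoint inequality of the tent is
  strict. These \<open>h\<close> form a set of positive measure, and for every other
  \<open>h\<close> the inequality still holds weakly.\<close>

lemma kernel_midpoint_less:
  assumes ac: "0 \<le> a" "a < c" "c \<le> L"
  shows "2 * kernel s L ((a + c) / 2) < kernel s L a + kernel s L c"
proof -
  let ?w = "\<lambda>h::real. \<bar>h\<bar> powr (1 + 2 * s)"
  define m where "m = (a + c) / 2"
  define g where "g d h = tent L h d / ?w h" for d h
  have gi: "integrable lborel (g d)" for d unfolding g_def by (rule integrable_kernel)
  have K: "kernel s L d = 1 / 2 * integral\<^sup>L lborel (g d)" for d by (simp add: kernel_def g_def[abs_def])
  define f where "f h = g a h + g c h - 2 * g m h" for h
  have feq: "f h = (tent L h a + tent L h c - 2 * tent L h m) / ?w h" for h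
    by (simp add: f_def g_def add_divide_distrib diff_divide_distrib)
  have conv: "2 * tent L h m \<le> tent L h a + tent L h c" for h
    using convex_onD[OF convex_on_tent[OF L, of h], of "1 / 2" a c] ac
    by (simp add: m_def field_simps)
  have fn: "0 \<le> f h" for h unfolding feq using conv[of h] by simp
  have fi: "integrable lborel f"
    unfolding f_def using gi by auto
  have int: "integral\<^sup>L lborel f = 2 * (kernel s L a + kernel s L c - 2 * kernel s L m)"
    unfolding f_def K using gi by simp
  have pos: "f h > 0" if h: "a < h" "h < c" for h
  proof -
    define b where "b = h / L"
    have fr: "frac (\<bar>h\<bar> / L) = b" using h ac L by (simp add: b_def frac_eq)
    have b: "a / L < b" "b < c / L" using h L by (auto simp: b_def divide_strict_right_mono)
    have ma: "m / L = (1 / 2) * (a / L) + (1 / 2) * (c / L)" by (simp add: m_def add_divide_distrib)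
    have aux: "2 * P < e \<Longrightarrow> e = A + C \<Longrightarrow> 2 * Q \<le> A' + C' \<Longrightarrow>
        2 * (P + Q - w) < (A + A' - w) + (C + C' - w)" for P Q A C A' C' e w :: real
      by simp
    \<comment> \<open>If the maximum is 0, this is \<open>a < h\<close>; otherwise the left side is
      \<open>(b - a / L) + (b - c / L)\<close> and the claim is \<open>h < c\<close>.\<close>
    have "2 * max 0 (b - m / L) < b - a / L" using b ma by (simp add: max_def)
    moreover have "b - a / L = max 0 (b - a / L) + max 0 (b - c / L)"
      using b by simp
    moreover have "2 * max 0 (b + m / L - 1) \<le> max 0 (b + a / L - 1) + max 0 (b + c / L - 1)"
      using ma by (simp add: max_def)
    ultimately have "2 * (max 0 (b - m / L) + max 0 (b + m / L - 1) - b\<^sup>2) <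
        (max 0 (b - a / L) + max 0 (b + a / L - 1) - b\<^sup>2) + (max 0 (b - c / L) + max 0 (b + c / L - 1) - b\<^sup>2)"
      by (rule aux)
    then have "L * (2 * (max 0 (b - m / L) + max 0 (b + m / L - 1) - b\<^sup>2)) <
        L * ((max 0 (b - a / L) + max 0 (b + a / L - 1) - b\<^sup>2) + (max 0 (b - c / L) + max 0 (b + c / L - 1) - b\<^sup>2))"
      using L by (intro mult_strict_left_mono) auto
    then have "2 * tent L h m < tent L h a + tent L h c"
      using ac L by (subst (1 2 3) tent_eq) (auto simp: m_def fr algebra_simps)
    moreover have "?w h > 0" using h ac by simp
    ultimately show ?thesis by (simp add: feq)
  qed
  have "integral\<^sup>L lborel f \<noteq> 0"
  proof
    assume "integral\<^sup>L lborel f = 0"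
    then have "AE h in lborel. f h = 0"
      using integral_nonneg_eq_0_iff_AE[OF fi] fn by auto
    then have "AE h in lborel. h \<notin> {a<..<c}"
      by eventually_elim (use pos in force)
    then have "emeasure lborel {a<..<c} = 0"
      by (subst (asm) AE_iff_measurable[of "{a<..<c}"]) auto
    then show False using ac by simp
  qed
  moreover have "integral\<^sup>L lborel f \<ge> 0" using fn by simp
  ultimately show ?thesis unfolding int m_def[symmetric] by simp
qed

end

section \<open>Symmetric second differences of the kernel\<close>

lemma max_zero_second_difference:
  fixes p t :: real
  shows "\<bar>max 0 (p + t) + max 0 (p - t) - 2 * max 0 p\<bar> \<le> 2 * \<bar>t\<bar>"
    and "\<bar>t\<bar> \<le> \<bar>p\<bar> \<Longrightarrow> max 0 (p + t) + max 0 (p - t) - 2 * max 0 p = 0"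
proof -
  define c where "c = \<bar>t\<bar>"
  have c: "c \<ge> 0" by (simp add: c_def)
  have e: "max 0 (p + t) + max 0 (p - t) = max 0 (p + c) + max 0 (p - c)"
    by (cases "t \<ge> 0") (simp_all add: c_def)
  \<comment> \<open>The step stays to the right of the kink, stays to the left of it, or crosses it;
    the first two cases are affine.\<close>
  consider "c \<le> p" | "p \<le> - c" | "\<bar>p\<bar> < c" by linarith
  then have "\<bar>max 0 (p + c) + max 0 (p - c) - 2 * max 0 p\<bar> \<le> 2 * c \<and>
    (c \<le> \<bar>p\<bar> \<longrightarrow> max 0 (p + c) + max 0 (p - c) - 2 * max 0 p = 0)"
  proof cases
    case 1
    then have "max 0 (p + c) = p + c" "max 0 (p - c) = p - c" "max 0 p = p" using c by simp_all
    then show ?thesis using c by simp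
  next
    case 2
    then have "max 0 (p + c) = 0" "max 0 (p - c) = 0" "max 0 p = 0" using c by simp_all
    then show ?thesis using c by simp
  next
    case 3
    then have *: "max 0 (p + c) = p + c" "max 0 (p - c) = 0" by simp_all
    have "max 0 p = (if p \<ge> 0 then p else 0)" by simp
    then show ?thesis unfolding * using 3 by (cases "p \<ge> 0") simp_all
  qed
  then show "\<bar>max 0 (p + t) + max 0 (p - t) - 2 * max 0 p\<bar> \<le> 2 * \<bar>t\<bar>"
    and "\<bar>t\<bar> \<le> \<bar>p\<bar> \<Longrightarrow> max 0 (p + t) + max 0 (p - t) - 2 * max 0 p = 0"
    unfolding e c_def by blast+
qed

text \<open>Here \<open>p\<close> and \<open>q\<close> are the arguments of the two hinges in
  \<open>tent_eq\<close>, so \<open>L * \<bar>p\<bar>\<close> and \<open>L * \<bar>q\<bar>\<close>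
  are the distances of \<open>d\<close> to the kinks. The constant 4 counts 2 for each
  hinge.\<close>

lemma tent_second_difference:
  fixes h :: real
  assumes L: "L > 0" and d: "0 \<le> d - \<bar>t\<bar>" "d + \<bar>t\<bar> \<le> L"
  defines "p \<equiv> frac (\<bar>h\<bar> / L) - d / L" and "q \<equiv> frac (\<bar>h\<bar> / L) + d / L - 1"
  shows "\<bar>tent L h (d + t) + tent L h (d - t) - 2 * tent L h d\<bar> \<le> 4 * \<bar>t\<bar>"
    and "\<bar>t\<bar> \<le> L * \<bar>p\<bar> \<Longrightarrow> \<bar>t\<bar> \<le> L * \<bar>q\<bar> \<Longrightarrow> tent L h (d + t) + tent L h (d - t) - 2 * tent L h d = 0"
proof -
  define r where "r = t / L"
  have *: "tent L h (d + t) + tent L h (d - t) - 2 * tent L h d =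
      L * ((max 0 (p + r) + max 0 (p - r) - 2 * max 0 p) + (max 0 (q + r) + max 0 (q - r) - 2 * max 0 q))"
    using L d by (subst (1 2 3) tent_eq) (auto simp: p_def q_def r_def algebra_simps add_divide_distrib diff_divide_distrib)
  have "\<bar>(max 0 (p + r) + max 0 (p - r) - 2 * max 0 p) + (max 0 (q + r) + max 0 (q - r) - 2 * max 0 q)\<bar>
      \<le> 4 * \<bar>r\<bar>"
    by (rule order.trans[OF abs_triangle_ineq order.trans[OF add_mono[OF
      max_zero_second_difference(1) max_zero_second_difference(1)]]]) simp
  then have "L * \<bar>(max 0 (p + r) + max 0 (p - r) - 2 * max 0 p) + (max 0 (q + r) + max 0 (q - r) - 2 * max 0 q)\<bar>
      \<le> L * (4 * \<bar>r\<bar>)" by (rule mult_left_mono[OF _ less_imp_le[OF L]])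
  also have "\<dots> = 4 * \<bar>t\<bar>" using L by (simp add: r_def)
  finally show "\<bar>tent L h (d + t) + tent L h (d - t) - 2 * tent L h d\<bar> \<le> 4 * \<bar>t\<bar>"
    unfolding * abs_mult abs_of_pos[OF L] .
  assume "\<bar>t\<bar> \<le> L * \<bar>p\<bar>" "\<bar>t\<bar> \<le> L * \<bar>q\<bar>"
  then have "\<bar>r\<bar> \<le> \<bar>p\<bar>" "\<bar>r\<bar> \<le> \<bar>q\<bar>" using L by (auto simp: r_def field_simps)
  then show "tent L h (d + t) + tent L h (d - t) - 2 * tent L h d = 0"
    unfolding * by (simp add: max_zero_second_difference(2))
qed

text \<open>The exceptional \<open>h\<close> are, up to sign, among the countably many values
  \<open>L * (c + k)\<close>. The purpose is that for almost every \<open>h\<close> a given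
  \<open>d\<close> is not a kink of the tent.\<close>

lemma AE_frac_neq:
  fixes L c :: real assumes "L > 0"
  shows "AE h in lborel. frac (\<bar>h\<bar> / L) \<noteq> c"
proof -
  define N where "N = (\<lambda>k::int. L * (c + of_int k)) ` UNIV \<union> (\<lambda>k::int. - (L * (c + of_int k))) ` UNIV"
  have "N \<in> null_sets lborel"
    unfolding N_def by (intro countable_imp_null_set_lborel) auto
  then have "AE h in lborel. h \<notin> N" by (rule AE_not_in)
  then show ?thesis
  proof eventually_elim
    case (elim h)
    show ?case
    proof
      assume "frac (\<bar>h\<bar> / L) = c"
      then have "\<bar>h\<bar> = L * (c + of_int (floor (\<bar>h\<bar> / L)))"
        using assms by (simp add: frac_def field_simps)
      then have "h \<in> N" by (cases "h \<ge> 0") (simp_all add: N_def image_iff, metis, metis minus_minus)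
      with elim show False by simp
    qed
  qed
qed

text \<open>
  Differentiability of the kernel itself is not needed: an equispaced configuration minimizes the
  energy, and a minimum is critical as soon as the symmetric second difference is of sublinear order.
\<close>

lemma kernel_second_difference_has_derivative_0:
  assumes s: "0 < s" "s < 1 / 2" and d: "0 < d" "d < L"
  shows "((\<lambda>t. kernel s L (d + t) + kernel s L (d - t) - 2 * kernel s L d) has_real_derivative 0) (at 0)"
proof -
  have L: "L > 0" using d by simp
  let ?w = "\<lambda>h::real. \<bar>h\<bar> powr (1 + 2 * s)"
  define g where "g d h = tent L h d / ?w h" for d h
  have gi: "integrable lborel (g d)" for d unfolding g_def by (rule integrable_kernel[OF s L])
  have K: "kernel s L d = 1 / 2 * integral\<^sup>L lborel (g d)" for d by (simp add: kernel_def g_def[abs_def])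
  define S where "S h t = (tent L h (d + t) + tent L h (d - t) - 2 * tent L h d) / t / ?w h" for h t
  \<comment> \<open>With half the distance of \<open>d\<close> to the ends of the period,
    \<open>d - t\<close> and \<open>d + t\<close> stay inside for
    \<open>\<bar>t\<bar> \<le> \<delta>\<close>, and for \<open>\<bar>h\<bar> < \<delta>\<close>
    both kinks keep a distance of at least \<open>\<delta>\<close> from \<open>d\<close>.\<close>
  define \<delta> where "\<delta> = min d (L - d) / 2"
  have \<delta>: "\<delta> > 0" "\<delta> \<le> d - \<delta>" "\<delta> \<le> L - d - \<delta>" "\<delta> \<le> L" using d by (auto simp: \<delta>_def min_def)
  have int: "(kernel s L (d + t) + kernel s L (d - t) - 2 * kernel s L d) / t = 1 / 2 * integral\<^sup>L lborel (\<lambda>h. S h t)" for t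
  proof -
    have "integral\<^sup>L lborel (\<lambda>h. S h t) = (\<integral>h. (g (d + t) h + g (d - t) h - 2 * g d h) / t \<partial>lborel)"
      by (simp add: S_def g_def add_divide_distrib diff_divide_distrib mult.commute)
    also have "\<dots> = (integral\<^sup>L lborel (g (d + t)) + integral\<^sup>L lborel (g (d - t)) - 2 * integral\<^sup>L lborel (g d)) / t"
      using gi by simp
    finally show ?thesis by (simp add: K field_simps)
  qed
  \<comment> \<open>For \<open>\<bar>h\<bar> < \<delta>\<close> no kink is crossed and the left side
    is 0, which removes the singularity of the weight. Otherwise
    \<open>\<delta> \<le> min L \<bar>h\<bar>\<close>, so the Lipschitz constant 4 is absorbed by
    the majorant.\<close>
  have bound: "\<bar>S h t\<bar> \<le> 4 / \<delta> * (min L \<bar>h\<bar> / ?w h)" if t: "\<bar>t\<bar> \<le> \<delta>" "t \<noteq> 0" for h t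
  proof -
    have dt: "0 \<le> d - \<bar>t\<bar>" "d + \<bar>t\<bar> \<le> L" using \<delta> t by linarith+
    have "\<bar>(tent L h (d + t) + tent L h (d - t) - 2 * tent L h d) / t\<bar> \<le> 4 / \<delta> * min L \<bar>h\<bar>"
    proof (cases "\<bar>h\<bar> < \<delta>")
      case True
      define b where "b = frac (\<bar>h\<bar> / L)"
      have b: "b \<le> \<bar>h\<bar> / L" using L by (auto simp: b_def frac_le_self)
      then have "L * b \<le> \<delta>" using True L by (simp add: field_simps)
      moreover have "L * \<bar>b - d / L\<bar> = \<bar>L * b - d\<bar>" "L * \<bar>b + d / L - 1\<bar> = \<bar>L * b + d - L\<bar>"
        using L by (auto simp: abs_if field_simps)
      ultimately have "\<bar>t\<bar> \<le> L * \<bar>b - d / L\<bar>" "\<bar>t\<bar> \<le> L * \<bar>b + d / L - 1\<bar>"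
        using \<delta> t by linarith+
      then have "tent L h (d + t) + tent L h (d - t) - 2 * tent L h d = 0"
        unfolding b_def by (intro tent_second_difference L dt)
      then show ?thesis using \<delta> L by simp
    next
      case False
      have "\<bar>(tent L h (d + t) + tent L h (d - t) - 2 * tent L h d) / t\<bar> \<le> 4"
        using tent_second_difference(1)[OF L dt, of h] t by (simp add: field_simps)
      also have "\<dots> \<le> 4 / \<delta> * min L \<bar>h\<bar>" using False \<delta> by (simp add: field_simps)
      finally show ?thesis .
    qed
    then have "\<bar>(tent L h (d + t) + tent L h (d - t) - 2 * tent L h d) / t\<bar> / ?w h \<le> 4 / \<delta> * min L \<bar>h\<bar> / ?w h"
      by (intro divide_right_mono) auto
    then show ?thesis by (simp add: S_def abs_divide abs_mult)
  qed
  \<comment> \<open>If \<open>d\<close> is not a kink of the tent, all sufficiently small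
    \<open>t\<close> give 0; how small depends on \<open>h\<close>, so the limit needs
    domination.\<close>
  have conv: "AE h in lborel. \<forall>\<^sub>F t in at 0. S h t = 0"
    using AE_frac_neq[OF L, of "d / L"] AE_frac_neq[OF L, of "1 - d / L"]
  proof eventually_elim
    case (elim h)
    define p where "p = frac (\<bar>h\<bar> / L) - d / L"
    define q where "q = frac (\<bar>h\<bar> / L) + d / L - 1"
    have pq: "p \<noteq> 0" "q \<noteq> 0" using elim by (auto simp: p_def q_def)
    define \<eta> where "\<eta> = min \<delta> (min (L * \<bar>p\<bar>) (L * \<bar>q\<bar>))"
    have "\<eta> > 0" using pq \<delta> L by (simp add: \<eta>_def)
    moreover have "S h t = 0" if "\<bar>t\<bar> < \<eta>" for t
    proof -
      have t: "\<bar>t\<bar> \<le> \<delta>" "\<bar>t\<bar> \<le> L * \<bar>p\<bar>" "\<bar>t\<bar> \<le> L * \<bar>q\<bar>" using that by (auto simp: \<eta>_def)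
      have "tent L h (d + t) + tent L h (d - t) - 2 * tent L h d = 0"
        using t \<delta> unfolding p_def q_def by (intro tent_second_difference L) auto
      then show ?thesis by (simp add: S_def)
    qed
    ultimately show ?case unfolding eventually_at by (auto intro!: exI[of _ \<eta>])
  qed
  have "((\<lambda>t. integral\<^sup>L lborel (\<lambda>h. S h t)) \<longlongrightarrow> 0) (at 0)"
    unfolding tendsto_at_iff_sequentially o_def
  proof (intro allI impI)
    fix X :: "nat \<Rightarrow> real"
    assume X: "\<forall>i. X i \<in> UNIV - {0}" "X \<longlonglongrightarrow> 0"
    then have Xat: "filterlim X (at 0) sequentially" by (simp add: filterlim_at)
    \<comment> \<open>Dominated convergence runs along a sequence; dropping its first
      \<open>n0\<close> terms brings it into the range where \<open>bound\<close> applies.\<close>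
    from X(2) \<delta>(1) obtain n0 where n0: "\<And>n. n \<ge> n0 \<Longrightarrow> \<bar>X n\<bar> < \<delta>"
      by (auto simp: LIMSEQ_def)
    have "(\<lambda>n. integral\<^sup>L lborel (\<lambda>h. S h (X (n + n0)))) \<longlonglongrightarrow> integral\<^sup>L lborel (\<lambda>h::real. 0)"
    proof (rule integral_dominated_convergence)
      show "integrable lborel (\<lambda>h. 4 / \<delta> * (min L \<bar>h\<bar> / ?w h))"
        using integrable_min_weight[OF s L] by (intro integrable_mult_right)
      show "AE h in lborel. (\<lambda>n. S h (X (n + n0))) \<longlonglongrightarrow> 0"
        using conv
      proof eventually_elim
        case (elim h)
        have "\<forall>\<^sub>F n in sequentially. S h (X n) = 0"
          by (rule eventually_compose_filterlim[OF elim Xat])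
        then have "(\<lambda>n. S h (X n)) \<longlonglongrightarrow> 0" by (simp add: tendsto_eventually)
        then show ?case by (rule LIMSEQ_ignore_initial_segment)
      qed
      show "AE h in lborel. norm (S h (X (n + n0))) \<le> 4 / \<delta> * (min L \<bar>h\<bar> / ?w h)" for n
        using bound[of "X (n + n0)"] n0[of "n + n0"] X(1) by (auto intro!: AE_I2)
    qed (auto simp: S_def)
    then show "(\<lambda>n. integral\<^sup>L lborel (\<lambda>h. S h (X n))) \<longlonglongrightarrow> 0"
      by (simp add: LIMSEQ_offset)
  qed
  then have "((\<lambda>t. 1 / 2 * integral\<^sup>L lborel (\<lambda>h. S h t)) \<longlongrightarrow> 0) (at 0)"
    using tendsto_mult_right_zero by blast
  then show ?thesis unfolding DERIV_def by (simp add: int)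
qed

section \<open>Cyclically ordered points with a convex interaction\<close>

lemma sum_window_Suc:
  fixes g :: "nat \<Rightarrow> real"
  shows "(\<Sum>m<N. g (Suc k + m)) = (\<Sum>m<N. g (k + m)) + g (k + N) - g k"
  by (induction N) auto

lemma sum_window_periodic:
  fixes g :: "nat \<Rightarrow> real"
  assumes "\<And>k. g (k + N) = g k"
  shows "(\<Sum>m<N. g (k + m)) = (\<Sum>m<N. g m)"
  by (induction k) (simp, simp only: sum_window_Suc assms)

text \<open>Separates the properties on which the minimization rests from the integral formula for
  the kernel. The period equals the number of points, so that equal gaps are gaps of length
  1.\<close>

locale circle_kernel =
  fixes K :: "real \<Rightarrow> real" and N :: nat
  assumes N_pos: "0 < N"
    and K_minus: "K (- d) = K d"
    and K_periodic: "K (d + real N * of_int k) = K d"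
    and K_convex: "convex_on {0..real N} K"
    and K_midpoint: "0 \<le> a \<Longrightarrow> a < c \<Longrightarrow> c \<le> real N \<Longrightarrow> 2 * K ((a + c) / 2) < K a + K c"
begin

definition seq_energy :: "(nat \<Rightarrow> real) \<Rightarrow> real" where
  "seq_energy x = (\<Sum>k<N. \<Sum>l<N. K (x l - x k))"

text \<open>Continues \<open>N\<close> positions to all indices, adding one period per turn. Cyclic
  differences become \<open>lift x (k + m) - lift x k\<close>, with no case distinction at the
  wrap-around.\<close>

definition lift :: "(nat \<Rightarrow> real) \<Rightarrow> nat \<Rightarrow> real" where
  "lift x k = x (k mod N) + real N * real (k div N)"

definition min_energy :: real where
  "min_energy = real N * (\<Sum>m<N. K (real m))"

lemma lift_less: "k < N \<Longrightarrow> lift x k = x k"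
  by (simp add: lift_def)

lemma lift_add_N: "lift x (k + N) = lift x k + real N"
  using N_pos by (simp add: lift_def algebra_simps)

text \<open>By periodicity of \<open>K\<close>, the sum over any \<open>N\<close> consecutive lifted
  indices is the same, so the window may start at \<open>k\<close>. Grouping by the index distance
  \<open>m\<close> is what makes Jensen applicable, since the mean difference is then known.\<close>

lemma seq_energy_eq: "seq_energy x = (\<Sum>m<N. \<Sum>k<N. K (lift x (k + m) - lift x k))"
proof -
  have "(\<Sum>l<N. K (x l - x k)) = (\<Sum>m<N. K (lift x (k + m) - lift x k))" if "k < N" for k
  proof -
    have "(\<Sum>m<N. K (lift x (k + m) - lift x k)) = (\<Sum>m<N. K (lift x m - lift x k))"
    proof (rule sum_window_periodic)
      fix j
      show "K (lift x (j + N) - lift x k) = K (lift x j - lift x k)"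
        unfolding lift_add_N using K_periodic[of "lift x j - lift x k" 1] by (simp add: algebra_simps)
    qed
    also have "\<dots> = (\<Sum>l<N. K (x l - x k))"
      using that by (simp add: lift_less)
    finally show ?thesis by simp
  qed
  then have "seq_energy x = (\<Sum>k<N. \<Sum>m<N. K (lift x (k + m) - lift x k))"
    by (simp add: seq_energy_def)
  also have "\<dots> = (\<Sum>m<N. \<Sum>k<N. K (lift x (k + m) - lift x k))" by (rule sum.swap)
  finally show ?thesis .
qed

text \<open>Moving the summation window by one index replaces a term by the same term plus
  \<open>N\<close>; this happens \<open>m\<close> times.\<close>

lemma sum_lift_diff: "(\<Sum>k<N. lift x (k + m) - lift x k) = real N * real m"
proof -
  have "(\<Sum>k<N. lift x (m + k)) = (\<Sum>k<N. lift x k) + real N * real m"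
    by (induction m) (simp, simp only: sum_window_Suc lift_add_N, simp add: algebra_simps)
  then show ?thesis by (simp add: sum_subtractf add.commute)
qed

lemma mono_lift:
  assumes "\<And>k l. k \<le> l \<Longrightarrow> l < N \<Longrightarrow> x k \<le> x l" and "\<And>k. k < N \<Longrightarrow> x k \<in> {0..<real N}"
  shows "mono (lift x)"
  unfolding mono_iff_le_Suc
proof
  fix k
  show "lift x k \<le> lift x (Suc k)"
  proof (cases "Suc (k mod N) = N")
    case True
    \<comment> \<open>At the end of a turn the next lifted point is \<open>x 0\<close> plus a full
      period, which no position within the period exceeds.\<close>
    have "x (k mod N) \<le> real N" "0 \<le> x 0"
      using assms(2)[of "k mod N"] assms(2)[of 0] N_pos by auto
    with True show ?thesis by (simp add: lift_def mod_Suc div_Suc algebra_simps)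
  next
    case False
    have "k mod N < N" using N_pos by simp
    with False have "Suc (k mod N) < N" by linarith
    with assms(1)[of "k mod N" "Suc (k mod N)"] False show ?thesis
      by (simp add: lift_def mod_Suc div_Suc)
  qed
qed

lemma lift_diff_range:
  assumes "mono (lift x)" "m \<le> N"
  shows "lift x (k + m) - lift x k \<in> {0..real N}"
  using monoD[OF assms(1), of k "k + m"] monoD[OF assms(1), of "k + m" "k + N"] assms(2)
  by (simp add: lift_add_N)

lemma jensen:
  assumes "\<And>k. k < N \<Longrightarrow> g k \<in> {0..real N}" and "(\<Sum>k<N. g k) = real N * m"
  shows "real N * K m \<le> (\<Sum>k<N. K (g k))"
proof -
  have "K (\<Sum>k<N. (1 / real N) *\<^sub>R g k) \<le> (\<Sum>k<N. (1 / real N) * K (g k))"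
    using assms(1) N_pos by (intro convex_on_sum[OF _ _ K_convex]) (auto simp: lessThan_empty_iff)
  moreover have "(\<Sum>k<N. (1 / real N) *\<^sub>R g k) = m"
    using assms(2) N_pos by (simp flip: sum_divide_distrib)
  ultimately show ?thesis using N_pos by (simp flip: sum_divide_distrib add: field_simps)
qed

lemma min_energy_le:
  assumes "mono (lift x)" shows "min_energy \<le> seq_energy x"
  unfolding min_energy_def seq_energy_eq sum_distrib_left
  using lift_diff_range[OF assms] by (intro sum_mono jensen) (auto simp: sum_lift_diff)

text \<open>
  Averaging each gap with the next one preserves the sum of the gaps and lowers the energy,
  strictly so unless all gaps agree.
\<close>

lemma lift_Suc_of_minimal:
  assumes mono: "mono (lift x)" and le: "seq_energy x \<le> min_energy"
  shows "lift x (Suc k) = lift x k + 1"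
proof -
  define g where "g k = lift x (Suc k) - lift x k" for k
  have per: "g (k + N) = g k" for k
    using lift_add_N[of x k] lift_add_N[of x "Suc k"] by (simp add: g_def)
  have rng: "g k \<in> {0..real N}" for k
    using lift_diff_range[OF mono, of 1 k] N_pos by (simp add: g_def)
  have sumg: "(\<Sum>k<N. g k) = real N * 1"
    using sum_lift_diff[of x 1] by (simp add: g_def)
  \<comment> \<open>Each distance \<open>m\<close> contributes at least its Jensen bound, while the
    total is at most the sum of these bounds; hence the contribution of \<open>m = 1\<close> cannot
    exceed its own. For \<open>N = 1\<close> that distance does not occur in the sum, but the only
    gap is 1 anyway.\<close>
  have eq: "(\<Sum>k<N. K (g k)) \<le> real N * K 1"
  proof (cases "N = 1")
    case True
    then show ?thesis using sumg by simp
  next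
    case False
    with N_pos have 1: "1 < N" by simp
    define a where "a m = real N * K (real m)" for m :: nat
    define b where "b m = (\<Sum>k<N. K (lift x (k + m) - lift x k))" for m
    have ab: "a m \<le> b m" if "m < N" for m
      unfolding a_def b_def using lift_diff_range[OF mono] that by (intro jensen) (auto simp: sum_lift_diff)
    have "sum b {..<N} \<le> sum a {..<N}"
      using le by (simp add: min_energy_def seq_energy_eq sum_distrib_left a_def b_def)
    moreover have "sum a ({..<N} - {1}) \<le> sum b ({..<N} - {1})" using ab by (intro sum_mono) auto
    moreover have "sum a {..<N} = a 1 + sum a ({..<N} - {1})" "sum b {..<N} = b 1 + sum b ({..<N} - {1})"
      using 1 by (simp_all add: sum.remove)
    ultimately have "b 1 \<le> a 1" by linarith
    then show ?thesis by (simp add: a_def b_def g_def)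
  qed
  have step: "K (g k) + K (g (Suc k)) \<ge> 2 * K ((g k + g (Suc k)) / 2)"
    and strict: "g k \<noteq> g (Suc k) \<Longrightarrow> K (g k) + K (g (Suc k)) > 2 * K ((g k + g (Suc k)) / 2)" for k
  proof -
    show *: "K (g k) + K (g (Suc k)) > 2 * K ((g k + g (Suc k)) / 2)" if "g k \<noteq> g (Suc k)"
      using K_midpoint[of "g k" "g (Suc k)"] K_midpoint[of "g (Suc k)" "g k"] rng[of k] rng[of "Suc k"] that
      by (cases "g k < g (Suc k)") (auto simp: add.commute)
    then show "K (g k) + K (g (Suc k)) \<ge> 2 * K ((g k + g (Suc k)) / 2)"
      by (cases "g k = g (Suc k)") auto
  qed
  have sh: "(\<Sum>k<N. g (Suc k)) = (\<Sum>k<N. g k)" "(\<Sum>k<N. K (g (Suc k))) = (\<Sum>k<N. K (g k))"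
    using sum_window_periodic[of g N 1] sum_window_periodic[of "\<lambda>k. K (g k)" N 1] per by simp_all
  \<comment> \<open>The averaged gaps still have mean 1, so Jensen bounds their energy from below;
    combined with \<open>eq\<close>, averaging cannot lower the energy strictly at any
    index.\<close>
  have "real N * K 1 \<le> (\<Sum>k<N. K ((g k + g (Suc k)) / 2))"
  proof (rule jensen)
    show "(g k + g (Suc k)) / 2 \<in> {0..real N}" for k using rng[of k] rng[of "Suc k"] by auto
    show "(\<Sum>k<N. (g k + g (Suc k)) / 2) = real N * 1"
      using sumg sh by (simp add: sum.distrib flip: sum_divide_distrib)
  qed
  with eq have le2: "(\<Sum>k<N. K (g k) + K (g (Suc k))) \<le> (\<Sum>k<N. 2 * K ((g k + g (Suc k)) / 2))"
    by (simp add: sum.distrib sh flip: sum_distrib_left)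
  have gstep: "g k = g (Suc k)" if "k < N" for k
  proof (rule ccontr)
    assume "g k \<noteq> g (Suc k)"
    then have "(\<Sum>k<N. 2 * K ((g k + g (Suc k)) / 2)) < (\<Sum>k<N. K (g k) + K (g (Suc k)))"
      using step strict that by (intro sum_strict_mono_ex1) auto
    with le2 show False by simp
  qed
  have g0: "g k = g 0" if "k < N" for k
    using that
  proof (induction k)
    case (Suc k)
    then show ?case using gstep[of k] by simp
  qed simp
  have "(\<Sum>k<N. g k) = (\<Sum>k<N. g 0)" by (intro sum.cong refl g0) simp
  then have "g 0 = 1" using sumg N_pos by simp
  moreover have "g k = g (k mod N)"
  proof (induction k rule: less_induct)
    case (less k)
    show ?case
    proof (cases "k < N")
      case False
      then have "g k = g (k - N)" using per[of "k - N"] by simp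
      also have "\<dots> = g ((k - N) mod N)" using less False N_pos by simp
      finally show ?thesis using False by (simp add: le_mod_geq)
    qed simp
  qed
  ultimately have "g k = 1" using g0[of "k mod N"] N_pos by simp
  then show ?thesis by (simp add: g_def)
qed

lemma lift_equispaced: "lift (\<lambda>k. c + real k) k = c + real k"
proof -
  have "real (k mod N) + real N * real (k div N) = real (k mod N + N * (k div N))"
    by (simp only: of_nat_add of_nat_mult)
  also have "\<dots> = real k" by (simp only: mod_mult_div_eq)
  finally show ?thesis by (simp add: lift_def)
qed

lemma seq_energy_equispaced: "seq_energy (\<lambda>k. c + real k) = min_energy"
  by (simp add: seq_energy_eq lift_equispaced min_energy_def sum_distrib_left)

text \<open>Lifting commutes with interpolation, and the differences of the equispaced target are
  exactly \<open>m\<close>. Each cyclic difference thus moves linearly from its old value to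
  \<open>m\<close> inside \<open>{0..real N}\<close>, where \<open>K\<close> is convex.\<close>

lemma seq_energy_interpolate:
  assumes mono: "mono (lift x)" and t: "0 \<le> t" "t \<le> 1"
  shows "seq_energy (\<lambda>k. (1 - t) * x k + t * (c + real k)) \<le> (1 - t) * seq_energy x + t * min_energy"
proof -
  define y where "y k = (1 - t) * x k + t * (c + real k)" for k
  have ly: "lift y k = (1 - t) * lift x k + t * (c + real k)" for k
  proof -
    have e: "c + real k = (c + real (k mod N)) + real N * real (k div N)"
      using lift_equispaced[of c k] by (simp add: lift_def)
    show ?thesis unfolding y_def lift_def e by (simp add: algebra_simps)
  qed
  have "seq_energy y \<le> (\<Sum>m<N. \<Sum>k<N. (1 - t) * K (lift x (k + m) - lift x k) + t * K (real m))"
    unfolding seq_energy_eq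
  proof (intro sum_mono)
    fix m k assume "m \<in> {..<N}" "k \<in> {..<N}"
    then have "K ((1 - t) *\<^sub>R (lift x (k + m) - lift x k) + t *\<^sub>R real m)
        \<le> (1 - t) * K (lift x (k + m) - lift x k) + t * K (real m)"
      using t by (intro convex_onD[OF K_convex] lift_diff_range[OF mono]) auto
    then show "K (lift y (k + m) - lift y k) \<le> (1 - t) * K (lift x (k + m) - lift x k) + t * K (real m)"
      by (simp add: ly algebra_simps)
  qed
  also have "\<dots> = (1 - t) * seq_energy x + t * min_energy"
    by (simp add: seq_energy_eq min_energy_def sum.distrib sum_distrib_left mult.left_commute)
  finally show ?thesis by (simp add: y_def[abs_def])
qed

end

section \<open>Configurations enumerated in cyclic order\<close>

lemma ex_sorting_bijection:
  fixes f :: "'a::finite \<Rightarrow> 'b::linorder"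
  obtains \<sigma> where "bij_betw \<sigma> {..<CARD('a)} UNIV"
    and "\<And>k l. k \<le> l \<Longrightarrow> l < CARD('a) \<Longrightarrow> f (\<sigma> k) \<le> f (\<sigma> l)"
proof -
  obtain ys :: "'a list" where ys: "set ys = UNIV" "distinct ys"
    using finite_distinct_list[of "UNIV :: 'a set"] by auto
  define xs where "xs = sort_key f ys"
  have xs: "set xs = UNIV" "distinct xs" "sorted (map f xs)" by (auto simp: xs_def ys)
  have len: "length xs = CARD('a)" using distinct_card[OF xs(2)] unfolding xs(1) by (rule sym)
  show ?thesis
  proof (rule that)
    show "bij_betw ((!) xs) {..<CARD('a)} UNIV"
      by (rule bij_betw_nth[OF xs(2)]) (simp_all only: xs(1) len)
    show "f (xs ! k) \<le> f (xs ! l)" if "k \<le> l" "l < CARD('a)" for k l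
      using sorted_nth_mono[OF xs(3), of k l] that len by simp
  qed
qed

definition pair_energy :: "(real \<Rightarrow> real) \<Rightarrow> real ^ 'n \<Rightarrow> real" where
  "pair_energy K X = (\<Sum>i\<in>UNIV. \<Sum>j\<in>UNIV. K (X $ i - X $ j))"

locale torus_kernel = circle_kernel K "CARD('n)" for K :: "real \<Rightarrow> real" and dummy :: "'n::finite itself"
begin

lemma pair_energy_eq_seq_energy:
  assumes "bij_betw \<sigma> {..<CARD('n)} UNIV"
  shows "pair_energy K (X :: real ^ 'n) = seq_energy (\<lambda>k. X $ \<sigma> k)"
proof -
  have "pair_energy K X = (\<Sum>k<CARD('n). \<Sum>l<CARD('n). K (X $ \<sigma> k - X $ \<sigma> l))"
    unfolding pair_energy_def by (simp flip: sum.reindex_bij_betw[OF assms])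
  also have "\<dots> = seq_energy (\<lambda>k. X $ \<sigma> k)"
    unfolding seq_energy_def by (rule sum.swap)
  finally show ?thesis .
qed

text \<open>Sorting by position gives the enumeration. Coincident points may be listed in any order,
  so non-regular configurations are covered as well.\<close>

lemma ex_cyclic_order:
  assumes "X \<in> (configs :: (real ^ 'n) set)"
  obtains \<sigma> where "bij_betw \<sigma> {..<CARD('n)} UNIV" "mono (lift (\<lambda>k. X $ \<sigma> k))"
proof -
  obtain \<sigma> where \<sigma>: "bij_betw \<sigma> {..<CARD('n)} UNIV"
    "\<And>k l. k \<le> l \<Longrightarrow> l < CARD('n) \<Longrightarrow> X $ \<sigma> k \<le> X $ \<sigma> l"
    using ex_sorting_bijection[of "\<lambda>i. X $ i"] by blast
  show ?thesis
    by (rule that[OF \<sigma>(1)], rule mono_lift) (use \<sigma> assms in \<open>auto simp: configs_def\<close>)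
qed

lemma min_energy_le_pair_energy:
  assumes "X \<in> (configs :: (real ^ 'n) set)" shows "min_energy \<le> pair_energy K X"
proof -
  obtain \<sigma> where "bij_betw \<sigma> {..<CARD('n)} UNIV" "mono (lift (\<lambda>k. X $ \<sigma> k))"
    using ex_cyclic_order[OF assms] by blast
  then show ?thesis using min_energy_le by (simp add: pair_energy_eq_seq_energy)
qed

lemma equispaced_of_minimal:
  assumes X: "X \<in> (configs :: (real ^ 'n) set)" and le: "pair_energy K X \<le> min_energy"
  shows "X \<in> equispaced_configs"
proof -
  obtain \<sigma> where \<sigma>: "bij_betw \<sigma> {..<CARD('n)} UNIV" and mono: "mono (lift (\<lambda>k. X $ \<sigma> k))"
    using ex_cyclic_order[OF X] by blast
  define \<tau> where "\<tau> = X $ \<sigma> 0"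
  have "lift (\<lambda>k. X $ \<sigma> k) k = \<tau> + real k" for k
  proof (induction k)
    case 0 then show ?case using N_pos by (simp add: lift_less \<tau>_def)
  next
    case (Suc k)
    then show ?case using lift_Suc_of_minimal[OF mono] le by (simp add: pair_energy_eq_seq_energy[OF \<sigma>])
  qed
  then have x: "X $ \<sigma> k = real k + \<tau>" if "k < CARD('n)" for k
    using lift_less[OF that, of "\<lambda>k. X $ \<sigma> k"] by simp
  have im: "\<sigma> ` {..<CARD('n)} = UNIV" using \<sigma> by (simp add: bij_betw_def)
  have "inj (\<lambda>i. X $ i)"
  proof (rule injI)
    fix i j assume "X $ i = X $ j"
    moreover obtain k l where "i = \<sigma> k" "j = \<sigma> l" "k < CARD('n)" "l < CARD('n)"
      using im by (metis UNIV_I imageE lessThan_iff)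
    ultimately show "i = j" using x by simp
  qed
  moreover have "vals X = (\<lambda>k. X $ \<sigma> k) ` {..<CARD('n)}"
  proof -
    have "vals X = (\<lambda>i. X $ i) ` \<sigma> ` {..<CARD('n)}" by (simp only: im vals_def)
    then show ?thesis by (simp only: image_image)
  qed
  then have "vals X = (\<lambda>j. real j + \<tau>) ` {0..<CARD('n)}"
    using x by (simp add: lessThan_atLeast0)
  \<comment> \<open>The last point sits at \<open>\<tau> + N - 1\<close>, with \<open>N\<close> the
    number of points, and must lie below \<open>N\<close>.\<close>
  moreover have "\<tau> \<in> {0..<1}"
  proof -
    have "0 \<le> \<tau>" using X by (simp add: configs_def \<tau>_def)
    moreover have "X $ \<sigma> (CARD('n) - 1) < real CARD('n)" using X by (simp add: configs_def)
    then have "\<tau> < 1" using x[of "CARD('n) - 1"] N_pos by (simp add: of_nat_diff)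
    ultimately show ?thesis by simp
  qed
  ultimately show ?thesis using X unfolding equispaced_configs_def regular_configs_def by blast
qed

lemma pair_energy_equispaced:
  assumes "X \<in> (equispaced_configs :: (real ^ 'n) set)" shows "pair_energy K X = min_energy"
proof -
  obtain \<tau> where X: "inj (\<lambda>i. X $ i)" "vals X = (\<lambda>j. real j + \<tau>) ` {0..<CARD('n)}"
    using assms by (auto simp: equispaced_configs_def regular_configs_def)
  \<comment> \<open>Injectivity makes this index unique; distinct values make
    \<open>\<sigma>\<close> injective, and counting makes it onto.\<close>
  define \<sigma> where "\<sigma> k = (THE i. X $ i = \<tau> + real k)" for k
  have x: "X $ \<sigma> k = \<tau> + real k" if "k < CARD('n)" for k
  proof -
    have "\<tau> + real k \<in> vals X" using X(2) that by (auto simp: add.commute)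
    then have "\<exists>!i. X $ i = \<tau> + real k" using X(1) by (auto simp: vals_def inj_def)
    then show ?thesis unfolding \<sigma>_def by (rule theI')
  qed
  have "inj_on \<sigma> {..<CARD('n)}"
    using x by (intro inj_onI) (metis add_left_cancel lessThan_iff of_nat_eq_iff)
  moreover have "\<sigma> ` {..<CARD('n)} = UNIV"
    using calculation by (intro card_subset_eq) (auto simp: card_image)
  ultimately have \<sigma>: "bij_betw \<sigma> {..<CARD('n)} UNIV" by (simp add: bij_betw_def)
  have "pair_energy K X = seq_energy (\<lambda>k. X $ \<sigma> k)" by (rule pair_energy_eq_seq_energy[OF \<sigma>])
  also have "\<dots> = seq_energy (\<lambda>k. \<tau> + real k)" by (simp add: seq_energy_def x)
  also have "\<dots> = min_energy" by (rule seq_energy_equispaced)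
  finally show ?thesis .
qed

lemma ex_descent_segment:
  assumes "X \<in> (configs :: (real ^ 'n) set)"
  obtains Y where "\<And>t. 0 \<le> t \<Longrightarrow> t \<le> 1 \<Longrightarrow>
    pair_energy K (X + t *\<^sub>R (Y - X)) \<le> (1 - t) * pair_energy K X + t * min_energy"
proof -
  obtain \<sigma> where \<sigma>: "bij_betw \<sigma> {..<CARD('n)} UNIV" and mono: "mono (lift (\<lambda>k. X $ \<sigma> k))"
    using ex_cyclic_order[OF assms] by blast
  \<comment> \<open>The point that comes at place \<open>k\<close> in the order of \<open>X\<close>
    is sent to position \<open>k\<close>. Only differences matter, so the offset is taken to be
    0.\<close>
  define Y :: "real ^ 'n" where "Y = (\<chi> i. real (inv_into {..<CARD('n)} \<sigma> i))"
  have Y: "Y $ \<sigma> k = 0 + real k" if "k < CARD('n)" for k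
    using \<sigma> that by (simp add: Y_def bij_betw_def inv_into_f_f)
  show ?thesis
  proof (rule that)
    fix t :: real assume t: "0 \<le> t" "t \<le> 1"
    have "pair_energy K (X + t *\<^sub>R (Y - X)) = seq_energy (\<lambda>k. (1 - t) * X $ \<sigma> k + t * (0 + real k))"
      unfolding pair_energy_eq_seq_energy[OF \<sigma>] seq_energy_def
      by (intro sum.cong refl) (simp add: Y algebra_simps)
    also have "\<dots> \<le> (1 - t) * seq_energy (\<lambda>k. X $ \<sigma> k) + t * min_energy"
      by (rule seq_energy_interpolate[OF mono t])
    finally show "pair_energy K (X + t *\<^sub>R (Y - X)) \<le> (1 - t) * pair_energy K X + t * min_energy"
      unfolding pair_energy_eq_seq_energy[OF \<sigma>] .
  qed
qed

lemma pair_energy_mod: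
  fixes X Y :: "real ^ 'n"
  assumes "\<And>i. \<exists>k::int. Y $ i = X $ i + real CARD('n) * of_int k"
  shows "pair_energy K Y = pair_energy K X"
proof -
  obtain k :: "'n \<Rightarrow> int" where k: "\<And>i. Y $ i = X $ i + real CARD('n) * of_int (k i)"
    using assms by metis
  have "K (Y $ i - Y $ j) = K (X $ i - X $ j)" for i j
    using K_periodic[of "X $ i - X $ j" "k i - k j"] by (simp add: k algebra_simps)
  then show ?thesis by (simp add: pair_energy_def)
qed

end

section \<open>Functions with vanishing distributional derivative\<close>

definition smooth :: "(real \<Rightarrow> real) \<Rightarrow> bool" where
  "smooth f \<longleftrightarrow> (\<forall>m x. (deriv ^^ m) f field_differentiable at x)"

lemma test_function_smooth:
  "test_function \<phi> \<longleftrightarrow> smooth \<phi> \<and> (\<exists>a b. \<forall>x. x \<notin> {a..b} \<longrightarrow> \<phi> x = 0)"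
  by (simp add: test_function_def smooth_def)

text \<open>Iterated derivatives never leave \<open>S\<close>, so no formula for higher derivatives
  is needed: it suffices to name a family of functions closed under differentiation.\<close>

lemma smooth_coinduct:
  assumes "f \<in> S"
    and "\<And>g. g \<in> S \<Longrightarrow> \<exists>g'\<in>S. \<forall>x. (g has_real_derivative g' x) (at x)"
  shows "smooth f"
proof -
  have S: "deriv g \<in> S" "g field_differentiable at x" if gS: "g \<in> S" for g x
  proof -
    obtain g' where g': "g' \<in> S" "\<And>x. (g has_real_derivative g' x) (at x)"
      using assms(2)[OF gS] by blast
    have "deriv g = g'" using DERIV_imp_deriv[OF g'(2)] by blast
    with g' show "deriv g \<in> S" "g field_differentiable at x"
      by (auto simp: field_differentiable_def)
  qed
  have "(deriv ^^ m) f \<in> S" for m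
    by (induction m) (auto simp: assms(1) S)
  with S show ?thesis by (auto simp: smooth_def)
qed

lemma smooth_deriv: "smooth f \<Longrightarrow> smooth (deriv f)"
  unfolding smooth_def by (metis funpow_swap1 funpow.simps(2) o_apply)

lemma smooth_has_deriv: "smooth f \<Longrightarrow> (f has_real_derivative deriv f x) (at x)"
  unfolding smooth_def
  by (metis DERIV_deriv_iff_field_differentiable funpow_0)

lemma smooth_isCont: "smooth f \<Longrightarrow> isCont f x"
  using smooth_has_deriv DERIV_isCont by blast

lemma smooth_antiderivative:
  assumes "\<And>x. (F has_real_derivative f x) (at x)" "smooth f"
  shows "smooth F"
  unfolding smooth_def
proof (intro allI)
  fix m x
  have "deriv F = f" using DERIV_imp_deriv[OF assms(1)] by blast
  then show "(deriv ^^ m) F field_differentiable at x"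
    using assms by (cases m) (auto simp: smooth_def field_differentiable_def funpow_swap1)
qed

lemma smooth_affine:
  assumes "smooth f" shows "smooth (\<lambda>x. f (c * x + d))"
proof (rule smooth_coinduct[of _ "{\<lambda>x. k * g (c * x + d) |k g. smooth g}"])
  show "(\<lambda>x. f (c * x + d)) \<in> {\<lambda>x. k * g (c * x + d) |k g. smooth g}"
    using assms by (auto intro!: exI[of _ 1] exI[of _ f])
next
  fix h assume "h \<in> {\<lambda>x. k * g (c * x + d) |k g. smooth g}"
  then obtain k g where h: "h = (\<lambda>x. k * g (c * x + d))" and g: "smooth g" by auto
  have "(h has_real_derivative (k * c) * deriv g (c * x + d)) (at x)" for x
    unfolding h by (auto intro!: derivative_eq_intros DERIV_chain'[of _ _ _ _ g] smooth_has_deriv[OF g])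
  with smooth_deriv[OF g] show "\<exists>g'\<in>{\<lambda>x. k * g (c * x + d) |k g. smooth g}. \<forall>x. (h has_real_derivative g' x) (at x)"
    by (intro bexI[of _ "\<lambda>x. (k * c) * deriv g (c * x + d)"]) auto
qed

lemma smooth_diff:
  assumes "smooth f" "smooth g" shows "smooth (\<lambda>x. f x - g x)"
proof (rule smooth_coinduct[of _ "{\<lambda>x. f x - g x |f g. smooth f \<and> smooth g}"])
  show "(\<lambda>x. f x - g x) \<in> {\<lambda>x. f x - g x |f g. smooth f \<and> smooth g}"
    using assms by auto
next
  fix h :: "real \<Rightarrow> real" assume "h \<in> {\<lambda>x. f x - g x |f g. smooth f \<and> smooth g}"
  then obtain f g where h: "h = (\<lambda>x. f x - g x)" and fg: "smooth f" "smooth g" by auto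
  have "(h has_real_derivative deriv f x - deriv g x) (at x)" for x
    unfolding h by (intro DERIV_diff smooth_has_deriv fg)
  with fg[THEN smooth_deriv] show "\<exists>h'\<in>{\<lambda>x. f x - g x |f g. smooth f \<and> smooth g}. \<forall>x. (h has_real_derivative h' x) (at x)"
    by (intro bexI[of _ "\<lambda>x. deriv f x - deriv g x"]) auto
qed

text \<open>Sums are included because the product rule leads out of the plain products.\<close>

inductive_set smooth_products :: "(real \<Rightarrow> real) set" where
  mult: "smooth f \<Longrightarrow> smooth g \<Longrightarrow> (\<lambda>x. f x * g x) \<in> smooth_products"
| add: "f \<in> smooth_products \<Longrightarrow> g \<in> smooth_products \<Longrightarrow> (\<lambda>x. f x + g x) \<in> smooth_products"

lemma smooth_mult:
  assumes "smooth f" "smooth g" shows "smooth (\<lambda>x. f x * g x)"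
proof (rule smooth_coinduct)
  show "(\<lambda>x. f x * g x) \<in> smooth_products" by (intro smooth_products.mult assms)
next
  fix h assume "h \<in> smooth_products"
  then show "\<exists>h'\<in>smooth_products. \<forall>x. (h has_real_derivative h' x) (at x)"
  proof induction
    case (mult f g)
    have "((\<lambda>x. f x * g x) has_real_derivative f x * deriv g x + deriv f x * g x) (at x)" for x
      using DERIV_mult[OF smooth_has_deriv[OF mult(1), of x] smooth_has_deriv[OF mult(2), of x]]
      by (simp add: algebra_simps)
    moreover have "(\<lambda>x. f x * deriv g x + deriv f x * g x) \<in> smooth_products"
      by (intro smooth_products.intros smooth_deriv mult)
    ultimately show ?case
      by (intro bexI[of _ "\<lambda>x. f x * deriv g x + deriv f x * g x"]) auto
  next
    case (add f g)
    then obtain f' g' where "f' \<in> smooth_products" "\<forall>x. (f has_real_derivative f' x) (at x)"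
      "g' \<in> smooth_products" "\<forall>x. (g has_real_derivative g' x) (at x)" by blast
    then show ?case
      by (intro bexI[of _ "\<lambda>x. f' x + g' x"]) (auto intro!: DERIV_add smooth_products.add)
  qed
qed

section \<open>Smooth approximations of indicators of intervals\<close>

lemma tendsto_poly_div_exp:
  fixes p :: "real poly"
  shows "((\<lambda>x. poly p x / exp x) \<longlongrightarrow> 0) at_top"
proof -
  have "((\<lambda>x. \<Sum>i\<le>degree p. coeff p i * (x ^ i / exp x)) \<longlongrightarrow> (\<Sum>i\<le>degree p. coeff p i * 0)) at_top"
    by (intro tendsto_intros tendsto_power_div_exp_0)
  then show ?thesis by (simp add: poly_altdef sum_divide_distrib)
qed

text \<open>The classical flat function \<open>exp (- 1 / x)\<close>, multiplied by a polynomial in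
  \<open>1 / x\<close> so that the family is closed under differentiation.\<close>

definition flat_exp :: "real poly \<Rightarrow> real \<Rightarrow> real" where
  "flat_exp p x = (if 0 < x then poly p (1 / x) * exp (- 1 / x) else 0)"

text \<open>For positive \<open>x\<close> this is the chain rule: differentiating
  \<open>1 / x\<close> produces the factor encoded by \<open>[:0, 0, 1:]\<close>, the square of the
  polynomial variable. At 0 exponential decay beats every polynomial.\<close>

lemma flat_exp_has_deriv:
  "(flat_exp p has_real_derivative flat_exp ([:0, 0, 1:] * (p - pderiv p)) x) (at x)"
proof -
  consider "x < 0" | "x = 0" | "x > 0" by linarith
  then show ?thesis
  proof cases
    case 1
    have "((\<lambda>_. 0) has_real_derivative 0) (at x)" by simp
    then have "(flat_exp p has_real_derivative 0) (at x)"
      by (rule has_field_derivative_transform_within_open[of _ _ _ "{..<0}"])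
        (use 1 in \<open>auto simp: flat_exp_def\<close>)
    with 1 show ?thesis by (simp add: flat_exp_def)
  next
    case 3
    have "((\<lambda>x. poly p (1 / x) * exp (- 1 / x)) has_real_derivative
        poly (pderiv p) (1 / x) * (- 1 / x\<^sup>2) * exp (- 1 / x) + poly p (1 / x) * (exp (- 1 / x) * (1 / x\<^sup>2))) (at x)"
      using 3 by (auto intro!: derivative_eq_intros DERIV_chain'[OF _ poly_DERIV] simp: power2_eq_square field_simps)
    also have "poly (pderiv p) (1 / x) * (- 1 / x\<^sup>2) * exp (- 1 / x) + poly p (1 / x) * (exp (- 1 / x) * (1 / x\<^sup>2))
        = flat_exp ([:0, 0, 1:] * (p - pderiv p)) x"
      using 3 by (simp add: flat_exp_def power2_eq_square field_simps)
    finally show ?thesis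
      by (rule has_field_derivative_transform_within_open[of _ _ _ "{0<..}"])
        (use 3 in \<open>auto simp: flat_exp_def\<close>)
  next
    case 2
    \<comment> \<open>The extra power in \<open>pCons 0 p\<close> absorbs the division by
      \<open>h\<close> in the difference quotient.\<close>
    have "((\<lambda>h. poly (pCons 0 p) (inverse h) / exp (inverse h)) \<longlongrightarrow> 0) (at_right 0)"
      by (rule filterlim_compose[OF tendsto_poly_div_exp filterlim_inverse_at_top_right])
    then have "((\<lambda>h. flat_exp p h / h) \<longlongrightarrow> 0) (at_right 0)"
    proof (rule Lim_transform_eventually)
      show "\<forall>\<^sub>F h in at_right 0. poly (pCons 0 p) (inverse h) / exp (inverse h) = flat_exp p h / h"
        using eventually_at_right_less[of "0::real"]
        by eventually_elim (simp add: flat_exp_def exp_minus field_simps)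
    qed
    moreover have "((\<lambda>h. flat_exp p h / h) \<longlongrightarrow> 0) (at_left 0)"
    proof (rule tendsto_eventually)
      show "\<forall>\<^sub>F h in at_left 0. flat_exp p h / h = 0"
        unfolding eventually_at_left_field by (rule exI[of _ "-1"]) (auto simp: flat_exp_def)
    qed
    ultimately have "((\<lambda>h. flat_exp p h / h) \<longlongrightarrow> 0) (at 0)" by (rule filterlim_split_at[rotated])
    with 2 show ?thesis by (simp add: DERIV_def) (simp add: flat_exp_def)
  qed
qed

lemma smooth_flat_exp: "smooth (flat_exp p)"
  by (rule smooth_coinduct[of _ "range flat_exp"]) (use flat_exp_has_deriv in blast)+

lemma flat_exp_1_range: "0 \<le> flat_exp 1 x" "flat_exp 1 x \<le> 1"
  by (auto simp: flat_exp_def)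

text \<open>As \<open>n\<close> grows, the two flanks steepen and the function tends from below to
  the indicator of the open interval.\<close>

definition bump :: "real \<Rightarrow> real \<Rightarrow> nat \<Rightarrow> real \<Rightarrow> real" where
  "bump a b n x = flat_exp 1 (real n * x + - (real n * a)) * flat_exp 1 (- real n * x + real n * b)"

lemma smooth_bump: "smooth (bump a b n)"
  unfolding bump_def by (intro smooth_mult smooth_affine smooth_flat_exp)

lemma bump_range: "0 \<le> bump a b n x" "bump a b n x \<le> 1"
  using flat_exp_1_range by (auto simp: bump_def intro: mult_le_one)

lemma bump_eq_0: "x \<notin> {a<..<b} \<Longrightarrow> bump a b n x = 0"
proof -
  assume "x \<notin> {a<..<b}"
  then have "real n * (x - a) \<le> 0 \<or> real n * (b - x) \<le> 0"
    by (auto simp: mult_le_0_iff)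
  then show ?thesis by (auto simp: bump_def flat_exp_def algebra_simps)
qed

lemma bump_tendsto: "(\<lambda>n. bump a b n x) \<longlonglongrightarrow> indicator {a<..<b} x"
proof (cases "x \<in> {a<..<b}")
  case True
  have *: "(\<lambda>n. flat_exp 1 (real n * c)) \<longlonglongrightarrow> 1" if "c > 0" for c
  proof -
    have "(\<lambda>n. exp (- (1 / c) * inverse (real n))) \<longlonglongrightarrow> exp (- (1 / c) * 0)"
      by (intro tendsto_intros lim_inverse_n)
    moreover have "\<forall>\<^sub>F n in sequentially. exp (- (1 / c) * inverse (real n)) = flat_exp 1 (real n * c)"
      using eventually_gt_at_top[of "0::nat"]
      by eventually_elim (use that in \<open>auto simp: flat_exp_def field_simps\<close>)
    ultimately show ?thesis using Lim_transform_eventually by fastforce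
  qed
  have "(\<lambda>n. flat_exp 1 (real n * (x - a)) * flat_exp 1 (real n * (b - x))) \<longlonglongrightarrow> 1 * 1"
    using True by (intro tendsto_mult *) auto
  then show ?thesis using True by (simp add: bump_def algebra_simps)
qed (simp add: bump_eq_0)

lemma integrable_locally_mult:
  fixes v g :: "real \<Rightarrow> real"
  assumes v: "locally_integrable v" and g: "g \<in> borel_measurable borel"
    and bd: "\<And>x. \<bar>g x\<bar> \<le> C" and supp: "\<And>x. x \<notin> {a..b} \<Longrightarrow> g x = 0"
  shows "integrable lborel (\<lambda>x. v x * g x)"
proof -
  have i: "integrable lborel (\<lambda>x. indicator {a..b} x * v x)"
    using v by (auto simp: locally_integrable_def set_integrable_def)
  then have "integrable lborel (\<lambda>x. C * (indicator {a..b} x * v x))" by simp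
  then have "integrable lborel (\<lambda>x. (indicator {a..b} x * v x) * g x)"
  proof (rule Bochner_Integration.integrable_bound)
    show "AE x in lborel. norm ((indicator {a..b} x * v x) * g x) \<le> norm (C * (indicator {a..b} x * v x))"
    proof (rule AE_I2)
      fix x
      have "\<bar>g x\<bar> * \<bar>indicator {a..b} x * v x\<bar> \<le> \<bar>C\<bar> * \<bar>indicator {a..b} x * v x\<bar>"
        using bd[of x] by (intro mult_right_mono) auto
      then show "norm ((indicator {a..b} x * v x) * g x) \<le> norm (C * (indicator {a..b} x * v x))"
        by (simp only: real_norm_def abs_mult mult.commute)
    qed
  qed (use g borel_measurable_integrable[OF i] in measurable)
  moreover have "(\<lambda>x. (indicator {a..b} x * v x) * g x) = (\<lambda>x. v x * g x)"
    using supp by (auto simp: indicator_def fun_eq_iff)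
  ultimately show ?thesis by simp
qed

lemma ex_antiderivative:
  fixes f :: "real \<Rightarrow> real"
  assumes "\<And>x. isCont f x"
  obtains F where "\<And>x. (F has_real_derivative f x) (at x)"
proof -
  obtain F where "\<forall>x::real. - \<infinity> < ereal x \<longrightarrow> ereal x < \<infinity> \<longrightarrow> (F has_vector_derivative f x) (at x)"
    using einterval_antiderivative[of "-\<infinity>" "\<infinity>" f] assms by auto
  then show ?thesis by (intro that) (auto simp: has_real_derivative_iff_has_vector_derivative)
qed

lemma eq_of_deriv_zero_on:
  fixes F :: "real \<Rightarrow> real"
  assumes F: "\<And>x. (F has_real_derivative f x) (at x)"
    and z: "\<And>x. x \<in> {min p q<..<max p q} \<Longrightarrow> f x = 0"
  shows "F p = F q"
proof -
  have *: "F p = F q" if pq: "p < q" "\<And>x. x \<in> {p<..<q} \<Longrightarrow> f x = 0" for p q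
  proof -
    obtain z where "p < z" "z < q" "F q - F p = (q - p) * f z"
      using MVT2[OF pq(1), of F f] F by blast
    then show ?thesis using pq(2)[of z] by simp
  qed
  show ?thesis
  proof (cases p q rule: linorder_cases)
    case less
    show ?thesis by (rule *[OF less]) (use less in \<open>auto intro!: z\<close>)
  next
    case greater
    show ?thesis by (rule *[OF greater, symmetric]) (use greater in \<open>auto intro!: z\<close>)
  qed simp
qed

section \<open>Interval integrals under a vanishing distributional derivative\<close>

definition ioo_integral :: "(real \<Rightarrow> real) \<Rightarrow> real \<Rightarrow> real \<Rightarrow> real" where
  "ioo_integral v a b = (\<integral>x. v x * indicator {a<..<b} x \<partial>lborel)"

context
  fixes v :: "real \<Rightarrow> real"
  assumes v: "locally_integrable v"
    and zero: "\<And>\<phi>. test_function \<phi> \<Longrightarrow> (\<integral>x. v x * deriv \<phi> x \<partial>lborel) = 0"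
begin

text \<open>A bump minus its translate has total integral 0, so its antiderivative
  \<open>\<phi>\<close> has bounded support again and is a test function. Outside that support the
  interval between \<open>x - c\<close> and \<open>x\<close> misses the bump.\<close>

lemma integral_bump_shift:
  "(\<integral>x. v x * bump a b n x \<partial>lborel) = (\<integral>x. v x * bump a b n (x - c) \<partial>lborel)"
proof -
  define g where "g = bump a b n"
  have g: "smooth g" by (simp add: g_def smooth_bump)
  have gc: "smooth (\<lambda>x. g (x - c))" using smooth_affine[OF g, of 1 "- c"] by simp
  have gz: "x \<notin> {a<..<b} \<Longrightarrow> g x = 0" for x by (simp add: g_def bump_eq_0)
  have gb: "\<bar>g x\<bar> \<le> 1" for x using bump_range[of a b n x] by (simp add: g_def)
  obtain G where G: "\<And>x. (G has_real_derivative g x) (at x)"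
    using ex_antiderivative[OF smooth_isCont[OF g]] by blast
  define \<phi> where "\<phi> x = G x - G (x - c)" for x
  have d: "(\<phi> has_real_derivative g x - g (x - c)) (at x)" for x
    unfolding \<phi>_def[abs_def]
    by (intro DERIV_diff G) (use DERIV_shift[of G "g (x - c)" x "-c"] G in auto)
  have "smooth \<phi>" by (rule smooth_antiderivative[OF d]) (intro smooth_diff g gc)
  moreover have "\<phi> x = 0" if "x \<notin> {a - \<bar>c\<bar>..b + \<bar>c\<bar>}" for x
  proof -
    have "G x = G (x - c)"
      by (rule eq_of_deriv_zero_on[OF G], rule gz) (use that in auto)
    then show ?thesis by (simp add: \<phi>_def)
  qed
  ultimately have "test_function \<phi>" unfolding test_function_smooth by blast
  moreover have "deriv \<phi> = (\<lambda>x. g x - g (x - c))" using DERIV_imp_deriv[OF d] by blast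
  ultimately have "(\<integral>x. v x * (g x - g (x - c)) \<partial>lborel) = 0" using zero by fastforce
  then have "(\<integral>x. v x * g x - v x * g (x - c) \<partial>lborel) = 0" by (simp add: algebra_simps)
  moreover have "integrable lborel (\<lambda>x. v x * g x)"
    by (rule integrable_locally_mult[where g = g and C = 1 and a = a and b = b, OF v])
      (use gz gb smooth_isCont[OF g] in \<open>auto intro!: borel_measurable_continuous_onI continuous_at_imp_continuous_on\<close>)
  moreover have "integrable lborel (\<lambda>x. v x * g (x - c))"
    by (rule integrable_locally_mult[where g = "\<lambda>x. g (x - c)" and C = 1 and a = "a + c" and b = "b + c", OF v])
      (use gz gb smooth_isCont[OF gc] in \<open>auto intro!: borel_measurable_continuous_onI continuous_at_imp_continuous_on\<close>)
  ultimately show ?thesis unfolding g_def by simp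
qed

lemma integrable_ioo: "integrable lborel (\<lambda>x. v x * indicator {a<..<b} x)"
  by (rule integrable_locally_mult[OF v, of _ 1 a b]) (auto simp: indicator_def)

lemma v_indicator_measurable: "(\<lambda>x. v x * indicator {a<..<b} x) \<in> borel_measurable borel"
  using integrable_ioo[THEN borel_measurable_integrable] by simp

text \<open>The bumps are dominated by the indicator to which they converge, so translation
  invariance passes from bumps to intervals.\<close>

lemma ioo_integral_shift: "ioo_integral v (a + c) (b + c) = ioo_integral v a b"
proof -
  have lim: "(\<lambda>n. \<integral>x. v x * bump a b n (x - d) \<partial>lborel) \<longlonglongrightarrow> ioo_integral v (a + d) (b + d)" for d
    unfolding ioo_integral_def
  proof (rule integral_dominated_convergence)
    show "(\<lambda>x. v x * indicator {a + d<..<b + d} x) \<in> borel_measurable lborel"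
      using v_indicator_measurable by simp
    have bm: "(\<lambda>x. bump a b n (x - d)) \<in> borel_measurable borel" for n
      using smooth_affine[OF smooth_bump, of a b n 1 "- d"] smooth_isCont
      by (auto intro!: borel_measurable_continuous_onI continuous_at_imp_continuous_on)
    have "integrable lborel (\<lambda>x. v x * bump a b n (x - d))" for n
      using bump_range by (intro integrable_locally_mult[OF v bm, of _ 1 "a + d" "b + d"])
        (auto intro!: bump_eq_0)
    then show "(\<lambda>x. v x * bump a b n (x - d)) \<in> borel_measurable lborel" for n by auto
    show "integrable lborel (\<lambda>x. \<bar>v x * indicator {a + d<..<b + d} x\<bar>)"
      using integrable_ioo by (intro integrable_abs)
    show "AE x in lborel. (\<lambda>n. v x * bump a b n (x - d)) \<longlonglongrightarrow> v x * indicator {a + d<..<b + d} x"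
    proof (intro AE_I2 tendsto_mult tendsto_const)
      fix x
      have "indicator {a<..<b} (x - d) = (indicator {a + d<..<b + d} x :: real)"
        by (auto simp: indicator_def)
      then show "(\<lambda>n. bump a b n (x - d)) \<longlonglongrightarrow> indicator {a + d<..<b + d} x"
        using bump_tendsto[of a b "x - d"] by simp
    qed
    show "AE x in lborel. norm (v x * bump a b n (x - d)) \<le> \<bar>v x * indicator {a + d<..<b + d} x\<bar>" for n
    proof (rule AE_I2)
      fix x
      show "norm (v x * bump a b n (x - d)) \<le> \<bar>v x * indicator {a + d<..<b + d} x\<bar>"
      proof (cases "x \<in> {a + d<..<b + d}")
        case True
        then show ?thesis using bump_range[of a b n "x - d"] by (simp add: abs_mult mult_left_le)
      next
        case False
        then have "bump a b n (x - d) = 0" by (intro bump_eq_0) auto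
        then show ?thesis by simp
      qed
    qed
  qed
  have "(\<lambda>n. \<integral>x. v x * bump a b n x \<partial>lborel) \<longlonglongrightarrow> ioo_integral v a b"
    using lim[of 0] by simp
  then show ?thesis using lim[of c] LIMSEQ_unique unfolding integral_bump_shift[of a b _ c] by blast
qed

lemma ioo_integral_split:
  assumes "a \<le> b" "b \<le> c" shows "ioo_integral v a c = ioo_integral v a b + ioo_integral v b c"
proof -
  have "ioo_integral v a b + ioo_integral v b c =
      (\<integral>x. v x * indicator {a<..<b} x + v x * indicator {b<..<c} x \<partial>lborel)"
    unfolding ioo_integral_def by (intro Bochner_Integration.integral_add[symmetric] integrable_ioo)
  also have "\<dots> = ioo_integral v a c" unfolding ioo_integral_def
  proof (rule integral_cong_AE)
    show "AE x in lborel. v x * indicator {a<..<b} x + v x * indicator {b<..<c} x = v x * indicator {a<..<c} x"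
      using AE_lborel_singleton[of b] by eventually_elim (use assms in \<open>auto simp: indicator_def\<close>)
  qed (use v_indicator_measurable in auto)
  finally show ?thesis by simp
qed

text \<open>Shift invariance makes the integral an additive function of the length. Its deviation
  \<open>r\<close> from the linear function with the same value at 1 is additive, vanishes at 1 and
  is bounded on \<open>{0..1}\<close>, hence bounded on all lengths, hence 0.\<close>

lemma ioo_integral_linear:
  obtains \<kappa> where "\<And>a b. a \<le> b \<Longrightarrow> ioo_integral v a b = \<kappa> * (b - a)"
proof -
  define r where "r x = ioo_integral v 0 x - ioo_integral v 0 1 * x" for x
  have add: "r (x + y) = r x + r y" if "0 \<le> x" "0 \<le> y" for x y
    using ioo_integral_split[of 0 x "x + y"] ioo_integral_shift[of 0 x y] that
    by (simp add: r_def algebra_simps)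
  have r1: "r 1 = 0" by (simp add: r_def)
  have r0: "r 0 = 0" using add[of 0 0] by simp
  have mult: "r (real n * x) = real n * r x" if "0 \<le> x" for n x
    using that by (induction n) (auto simp: r0 add distrib_right)
  define B where "B = (\<integral>x. \<bar>v x * indicator {0<..<1} x\<bar> \<partial>lborel) + \<bar>ioo_integral v 0 1\<bar>"
  have b1: "\<bar>r x\<bar> \<le> B" if x: "0 \<le> x" "x \<le> 1" for x
  proof -
    have "\<bar>ioo_integral v 0 x\<bar> \<le> (\<integral>x. \<bar>v x * indicator {0<..<1} x\<bar> \<partial>lborel)"
      unfolding ioo_integral_def
    proof (rule order.trans[OF integral_abs_bound integral_mono])
      show "\<bar>v y * indicator {0<..<x} y\<bar> \<le> \<bar>v y * indicator {0<..<1} y\<bar>" for y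
        using x by (auto simp: indicator_def)
    qed (intro integrable_abs integrable_ioo)+
    moreover have "\<bar>ioo_integral v 0 1 * x\<bar> \<le> \<bar>ioo_integral v 0 1\<bar>"
      using x by (simp add: abs_mult mult_left_le)
    ultimately show ?thesis unfolding r_def B_def by linarith
  qed
  have b: "\<bar>r x\<bar> \<le> B" if "0 \<le> x" for x
  proof -
    have "x = frac x + real (nat (floor x)) * 1" using that by (simp add: frac_def)
    then have "r x = r (frac x) + real (nat (floor x)) * r 1"
      using add[of "frac x" "real (nat (floor x)) * 1"] mult[of 1 "nat (floor x)"] by (simp add: frac_ge_0)
    then show ?thesis using b1[of "frac x"] frac_lt_1[of x] by (simp add: r1 frac_ge_0)
  qed
  have rz: "r x = 0" if "0 \<le> x" for x
  proof (rule ccontr)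
    \<comment> \<open>Otherwise \<open>r (real n * x) = real n * r x\<close> would exceed every
      bound.\<close>
    assume "r x \<noteq> 0"
    then obtain n where "B < real n * \<bar>r x\<bar>" using ex_less_of_nat_mult[of "\<bar>r x\<bar>" B] by auto
    also have "\<dots> = \<bar>r (real n * x)\<bar>" using mult[OF that] by (simp add: abs_mult)
    also have "\<dots> \<le> B" using that by (intro b) auto
    finally show False by simp
  qed
  show ?thesis
  proof (rule that)
    fix a b :: real assume "a \<le> b"
    then show "ioo_integral v a b = ioo_integral v 0 1 * (b - a)"
      using rz[of "b - a"] ioo_integral_shift[of 0 a "b - a"] by (simp add: r_def)
  qed
qed

end

text \<open>The positive and the negative part of \<open>f\<close> are densities of finite measures
  that agree on all rays, hence everywhere. Since \<open>ennreal\<close> sends negative numbers to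
  0, equality of the two densities at \<open>x\<close> means \<open>f x = 0\<close>.\<close>

lemma AE_zero_of_ray_integrals:
  fixes f :: "real \<Rightarrow> real"
  assumes f: "integrable lborel f" and z: "\<And>a. (\<integral>x. f x * indicator {a<..} x \<partial>lborel) = 0"
  shows "AE x in lborel. f x = 0"
proof -
  have [measurable]: "f \<in> borel_measurable borel" using f by auto
  have fin: "(\<integral>\<^sup>+x. ennreal (g x) \<partial>lborel) < \<infinity>" if "integrable lborel g" for g :: "real \<Rightarrow> real"
    using that by (simp add: real_integrable_def less_top)
  have eq: "(\<integral>\<^sup>+x. ennreal (f x * indicator {a<..} x) \<partial>lborel) = (\<integral>\<^sup>+x. ennreal (- f x * indicator {a<..} x) \<partial>lborel)" for a
  proof -
    have i: "integrable lborel (\<lambda>x. f x * indicator {a<..} x)"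
      using f by (intro integrable_real_mult_indicator) auto
    have "enn2real (\<integral>\<^sup>+x. ennreal (f x * indicator {a<..} x) \<partial>lborel) =
        enn2real (\<integral>\<^sup>+x. ennreal (- (f x * indicator {a<..} x)) \<partial>lborel)"
      using z[of a] real_lebesgue_integral_def[OF i] by simp
    moreover have "(\<integral>\<^sup>+x. ennreal (f x * indicator {a<..} x) \<partial>lborel) < top"
      and "(\<integral>\<^sup>+x. ennreal (- (f x * indicator {a<..} x)) \<partial>lborel) < top"
      using fin[OF i] fin[OF Bochner_Integration.integrable_minus[OF i]] by simp_all
    ultimately have "(\<integral>\<^sup>+x. ennreal (f x * indicator {a<..} x) \<partial>lborel) =
        (\<integral>\<^sup>+x. ennreal (- (f x * indicator {a<..} x)) \<partial>lborel)"
      using ennreal_enn2real by metis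
    then show ?thesis by simp
  qed
  have em: "emeasure (density lborel (\<lambda>x. ennreal (g x))) {a<..} = (\<integral>\<^sup>+x. ennreal (g x * indicator {a<..} x) \<partial>lborel)"
    if [measurable]: "g \<in> borel_measurable borel" for g :: "real \<Rightarrow> real" and a
    by (subst emeasure_density) (auto intro!: nn_integral_cong simp: indicator_def)
  have "density lborel (\<lambda>x. ennreal (f x)) = density lborel (\<lambda>x. ennreal (- f x))"
  proof (rule measure_eqI_lessThan)
    show "emeasure (density lborel (\<lambda>x. ennreal (f x))) {a<..} < \<infinity>" for a
      using fin[OF integrable_real_mult_indicator[OF _ f, of "{a<..}"]] by (simp add: em)
    show "emeasure (density lborel (\<lambda>x. ennreal (f x))) {a<..} = emeasure (density lborel (\<lambda>x. ennreal (- f x))) {a<..}" for a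
      using eq[of a] by (simp add: em)
  qed auto
  then have "AE x in lborel. ennreal (f x) = ennreal (- f x)"
    using sigma_finite_measure.density_unique_iff[OF lborel.sigma_finite_measure_axioms, of "\<lambda>x. ennreal (f x)" "\<lambda>x. ennreal (- f x)"] by auto
  then show ?thesis
  proof eventually_elim
    case (elim x)
    then show ?case by (cases "f x \<ge> 0") (simp_all add: ennreal_neg)
  qed
qed

text \<open>As \<open>v\<close> is integrable only locally, \<open>v - \<kappa>\<close> is cut off
  to a bounded interval, where all its ray integrals vanish; countably many such intervals cover the
  line.\<close>

lemma AE_constant_of_zero_distributional_deriv:
  assumes v: "locally_integrable v"
    and zero: "\<And>\<phi>. test_function \<phi> \<Longrightarrow> (\<integral>x. v x * deriv \<phi> x \<partial>lborel) = 0"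
  obtains \<kappa> where "AE x in lborel. v x = \<kappa>"
proof -
  obtain \<kappa> where \<kappa>: "\<And>a b. a \<le> b \<Longrightarrow> ioo_integral v a b = \<kappa> * (b - a)"
    using ioo_integral_linear[OF v zero] by blast
  have "AE x in lborel. x \<in> {- real n<..<real n} \<longrightarrow> v x = \<kappa>" for n :: nat
  proof -
    define f where "f x = (v x - \<kappa>) * indicator {- real n<..<real n} x" for x
    have f': "f x = v x * indicator {- real n<..<real n} x - \<kappa> * indicator {- real n<..<real n} x" for x
      by (simp add: f_def algebra_simps)
    have ik: "integrable lborel (\<lambda>x. \<kappa> * indicator {a<..<b} x)" for a b :: real
      by (cases "a \<le> b") auto
    have "integrable lborel f"
      unfolding f'[abs_def] by (intro Bochner_Integration.integrable_diff integrable_ioo[OF v zero] ik)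
    moreover have "(\<integral>x. f x * indicator {a<..} x \<partial>lborel) = 0" for a
    proof (cases "max a (- real n) \<le> real n")
      case True
      have "f x * indicator {a<..} x = v x * indicator {max a (- real n)<..<real n} x
          - \<kappa> * indicator {max a (- real n)<..<real n} x" for x
        by (auto simp: f' indicator_def)
      then have "(\<integral>x. f x * indicator {a<..} x \<partial>lborel) =
          ioo_integral v (max a (- real n)) (real n) - \<kappa> * (real n - max a (- real n))"
        using True by (simp add: ioo_integral_def Bochner_Integration.integral_diff[OF integrable_ioo[OF v zero] ik] del: max_def)
      then show ?thesis using \<kappa>[OF True] by simp
    next
      case False
      then have "(\<lambda>x. f x * indicator {a<..} x) = (\<lambda>x. 0)" by (auto simp: f_def indicator_def)
      then show ?thesis by simp
    qed
    ultimately have "AE x in lborel. f x = 0" by (rule AE_zero_of_ray_integrals)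
    then show ?thesis by eventually_elim (auto simp: f_def indicator_def)
  qed
  then have "AE x in lborel. \<forall>n. x \<in> {- real n<..<real n} \<longrightarrow> v x = \<kappa>"
    by (intro AE_all_countable[THEN iffD2] allI)
  then have "AE x in lborel. v x = \<kappa>"
  proof eventually_elim
    case (elim x)
    obtain n where "\<bar>x\<bar> < real n" using reals_Archimedean2 by blast
    then show ?case using elim[rule_format, of n] by (simp add: abs_less_iff)
  qed
  then show ?thesis by (rule that)
qed

section \<open>The distributional derivative of the sawtooth\<close>

lemma test_function_bounds:
  assumes "test_function \<phi>"
  obtains R C where "R > 0" "\<And>x. R < \<bar>x\<bar> \<Longrightarrow> \<phi> x = 0" "\<And>x. R < \<bar>x\<bar> \<Longrightarrow> deriv \<phi> x = 0"
    "\<And>x. \<bar>\<phi> x\<bar> \<le> C" "\<And>x. \<bar>deriv \<phi> x\<bar> \<le> C"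
proof -
  have s: "smooth \<phi>" and "\<exists>a b. \<forall>x. x \<notin> {a..b} \<longrightarrow> \<phi> x = 0"
    using assms by (auto simp: test_function_smooth)
  then obtain a b where ab: "\<And>x. x \<notin> {a..b} \<Longrightarrow> \<phi> x = 0" by blast
  define R where "R = 1 + \<bar>a\<bar> + \<bar>b\<bar>"
  have z: "\<phi> x = 0" if "R < \<bar>x\<bar>" for x
    using that by (intro ab) (auto simp: R_def)
  have z': "deriv \<phi> x = 0" if "R < \<bar>x\<bar>" for x
  proof -
    have "((\<lambda>_. 0) has_real_derivative 0) (at x)" by simp
    then have "(\<phi> has_real_derivative 0) (at x)"
      by (rule has_field_derivative_transform_within_open[of _ _ _ "- {-R..R}"])
        (use that z in \<open>auto simp: abs_if split: if_splits\<close>)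
    then show ?thesis by (rule DERIV_imp_deriv)
  qed
  have bd: "\<exists>C. \<forall>x. \<bar>f x\<bar> \<le> C" if f: "smooth f" "\<And>x. R < \<bar>x\<bar> \<Longrightarrow> f x = 0" for f
  proof -
    have "compact (f ` {-R..R})"
      by (intro compact_continuous_image continuous_at_imp_continuous_on ballI smooth_isCont f(1) compact_Icc)
    then have "bounded (f ` {-R..R})" by (rule compact_imp_bounded)
    then obtain C where C: "\<And>y. y \<in> f ` {-R..R} \<Longrightarrow> \<bar>y\<bar> \<le> C"
      unfolding bounded_real by blast
    have "\<bar>f x\<bar> \<le> max C 0" for x
    proof (cases "R < \<bar>x\<bar>")
      case False
      then have "f x \<in> f ` {-R..R}" by (intro imageI) auto
      then show ?thesis using C by fastforce
    qed (simp add: f(2))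
    then show ?thesis by blast
  qed
  obtain C where C: "\<And>x. \<bar>\<phi> x\<bar> \<le> C" using bd[OF s z] by blast
  obtain C' where C': "\<And>x. \<bar>deriv \<phi> x\<bar> \<le> C'" using bd[OF smooth_deriv[OF s] z'] by blast
  show ?thesis
    by (rule that[of R "max C C'"])
      (use z z' C C' in \<open>auto simp: R_def le_max_iff_disj\<close>)
qed

lemma smooth_measurable: "smooth f \<Longrightarrow> f \<in> borel_measurable borel"
  using smooth_isCont by (auto intro!: borel_measurable_continuous_onI continuous_at_imp_continuous_on)

lemma locally_integrable_bounded:
  assumes "f \<in> borel_measurable borel" "\<And>x. \<bar>f x\<bar> \<le> C"
  shows "locally_integrable f"
  unfolding locally_integrable_def set_integrable_def
proof (intro allI)
  fix a b :: real
  have "integrable lborel (\<lambda>x. indicator {a..b} x * C)" by (cases "a \<le> b") auto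
  then show "integrable lborel (\<lambda>x. indicator {a..b} x *\<^sub>R f x)"
    by (rule Bochner_Integration.integrable_bound)
      (use assms in \<open>auto intro!: AE_I2 order.trans[OF assms(2) abs_ge_self] simp: indicator_def\<close>)
qed

lemma locally_integrable_diff:
  "locally_integrable u \<Longrightarrow> locally_integrable v \<Longrightarrow> locally_integrable (\<lambda>x. u x - v x)"
  by (auto simp: locally_integrable_def)

lemma frac_abs_le: "\<bar>frac x\<bar> \<le> 1" for x :: real
  using frac_lt_1[of x] by (simp add: frac_ge_0 less_imp_le)

lemma locally_integrable_sawtooth: "locally_integrable (\<lambda>x. frac ((x - a) / L))"
  by (intro locally_integrable_bounded[of _ 1] frac_abs_le) measurable

lemma integrable_test_mult:
  assumes u: "locally_integrable u" and \<phi>: "test_function \<phi>"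
  shows "integrable lborel (\<lambda>x. u x * deriv \<phi> x)" "integrable lborel \<phi>"
proof -
  obtain R C where R: "\<And>x. R < \<bar>x\<bar> \<Longrightarrow> \<phi> x = 0" "\<And>x. R < \<bar>x\<bar> \<Longrightarrow> deriv \<phi> x = 0"
    "\<And>x. \<bar>\<phi> x\<bar> \<le> C" "\<And>x. \<bar>deriv \<phi> x\<bar> \<le> C"
    using test_function_bounds[OF \<phi>] by metis
  have s: "smooth \<phi>" using \<phi> by (simp add: test_function_smooth)
  have i: "integrable lborel (\<lambda>x. w x * \<phi> x)" if "locally_integrable w" for w
    using that R(1,3)
    by (intro integrable_locally_mult[where C = C and a = "- R" and b = R] smooth_measurable[OF s])
      (auto simp: not_le abs_if split: if_splits)
  show "integrable lborel (\<lambda>x. u x * deriv \<phi> x)"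
    using u R(2,4)
    by (intro integrable_locally_mult[where C = C and a = "- R" and b = R] smooth_measurable smooth_deriv s)
      (auto simp: not_le abs_if split: if_splits)
  show "integrable lborel \<phi>"
    using i[OF locally_integrable_bounded[of "\<lambda>_. 1" 1]] by simp
qed

text \<open>On each period the integrand is the derivative of \<open>((x - a) / L - k) * \<phi> x\<close>.\<close>

lemma has_integral_sawtooth_deriv_periods:
  assumes L: "L > 0" and s: "smooth \<phi>"
  shows "((\<lambda>x. frac ((x - a) / L) * deriv \<phi> x + \<phi> x / L) has_integral
      (\<Sum>j<n. \<phi> (a + L * of_int (k + 1 + int j)))) {a + L * of_int k..a + L * of_int (k + int n)}"
proof (induction n)
  case (Suc n)
  define m where "m = k + int n"
  define p where "p = a + L * of_int m"
  define q where "q = a + L * of_int (m + 1)"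
  have pq: "p \<le> q" using L by (simp add: p_def q_def)
  have "((\<lambda>x. ((x - a) / L - of_int m) * deriv \<phi> x + \<phi> x / L) has_integral
      ((q - a) / L - of_int m) * \<phi> q - ((p - a) / L - of_int m) * \<phi> p) {p..q}"
    using pq L by (intro fundamental_theorem_of_calculus)
      (auto intro!: derivative_eq_intros smooth_has_deriv[OF s, THEN has_field_derivative_at_within]
        simp flip: has_real_derivative_iff_has_vector_derivative)
  moreover have "((q - a) / L - of_int m) * \<phi> q - ((p - a) / L - of_int m) * \<phi> p = \<phi> q"
    using L by (simp add: p_def q_def)
  ultimately have "((\<lambda>x. ((x - a) / L - of_int m) * deriv \<phi> x + \<phi> x / L) has_integral \<phi> q) {p..q}" by simp
  then have "((\<lambda>x. frac ((x - a) / L) * deriv \<phi> x + \<phi> x / L) has_integral \<phi> q) {p..q}"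
  proof (rule has_integral_spike_finite[of "{q}", rotated 2])
    fix x assume x: "x \<in> {p..q} - {q}"
    have "of_int m \<le> (x - a) / L" "(x - a) / L < of_int m + 1"
      using x L by (auto simp: p_def q_def field_simps)
    then have "floor ((x - a) / L) = m" by linarith
    then show "frac ((x - a) / L) * deriv \<phi> x + \<phi> x / L = ((x - a) / L - of_int m) * deriv \<phi> x + \<phi> x / L"
      by (simp add: frac_def)
  qed auto
  moreover have "a + L * of_int k \<le> p" using L by (simp add: p_def m_def)
  ultimately have "((\<lambda>x. frac ((x - a) / L) * deriv \<phi> x + \<phi> x / L) has_integral
      (\<Sum>j<n. \<phi> (a + L * of_int (k + 1 + int j))) + \<phi> q) {a + L * of_int k..q}"
    using Suc.IH pq unfolding m_def[symmetric] p_def[symmetric] by (intro has_integral_combine)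
  then show ?case by (simp add: q_def m_def algebra_simps)
qed (simp add: has_integral_refl)

lemma integral_sawtooth_deriv:
  assumes L: "L > 0" and \<phi>: "test_function \<phi>"
    and M: "\<And>x. L * real M \<le> \<bar>x - a\<bar> \<Longrightarrow> \<phi> x = 0" "\<And>x. L * real M \<le> \<bar>x - a\<bar> \<Longrightarrow> deriv \<phi> x = 0"
  shows "(\<integral>x. frac ((x - a) / L) * deriv \<phi> x \<partial>lborel) =
    (\<Sum>k\<in>{- int M..int M}. \<phi> (a + L * of_int k)) - (\<integral>x. \<phi> x \<partial>lborel) / L"
proof -
  define h where "h x = frac ((x - a) / L) * deriv \<phi> x + \<phi> x / L" for x
  have s: "smooth \<phi>" using \<phi> by (simp add: test_function_smooth)
  have i: "integrable lborel (\<lambda>x. frac ((x - a) / L) * deriv \<phi> x)" "integrable lborel (\<lambda>x. \<phi> x / L)"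
    using integrable_test_mult[OF locally_integrable_sawtooth \<phi>] by auto
  have "(h has_integral (\<Sum>j<2 * M. \<phi> (a + L * of_int (- int M + 1 + int j))))
      {a + L * of_int (- int M)..a + L * of_int (- int M + int (2 * M))}"
    unfolding h_def by (rule has_integral_sawtooth_deriv_periods[OF L s])
  then have "(h has_integral (\<Sum>j<2 * M. \<phi> (a + L * of_int (- int M + 1 + int j)))) UNIV"
  proof (rule has_integral_on_superset)
    fix x assume "x \<notin> {a + L * of_int (- int M)..a + L * of_int (- int M + int (2 * M))}"
    then have "L * real M \<le> \<bar>x - a\<bar>" by auto
    with M show "h x = 0" by (simp add: h_def)
  qed auto
  moreover have "(h has_integral (\<integral>x. h x \<partial>lborel)) UNIV"
    unfolding h_def by (intro has_integral_integral_lborel Bochner_Integration.integrable_add i)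
  ultimately have "(\<integral>x. h x \<partial>lborel) = (\<Sum>j<2 * M. \<phi> (a + L * of_int (- int M + 1 + int j)))"
    by (rule has_integral_unique[rotated])
  also have "\<dots> = (\<Sum>k\<in>{- int M<..int M}. \<phi> (a + L * of_int k))"
    \<comment> \<open>The right endpoints of the \<open>2 * M\<close> periods carry the indices
      \<open>- M + 1\<close> to \<open>M\<close>. The index \<open>- M\<close> added next
      contributes 0, its point being at distance \<open>L * M\<close> from \<open>a\<close>.\<close>
    by (rule sum.reindex_bij_witness[of _ "\<lambda>k. nat (k + int M - 1)" "\<lambda>j. - int M + 1 + int j"]) auto
  also have "\<dots> = (\<Sum>k\<in>{- int M..int M}. \<phi> (a + L * of_int k))"
  proof (rule sum.mono_neutral_left)
    show "\<forall>k\<in>{- int M..int M} - {- int M<..int M}. \<phi> (a + L * of_int k) = 0"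
      using L by (auto intro!: M(1))
  qed auto
  finally show ?thesis using i by (simp add: h_def)
qed

text \<open>Each summand has slope \<open>1 / CARD('n)\<close> and drops by 1 at its jumps; the
  slopes of all \<open>CARD('n)\<close> summands add up to the density 1 of Lebesgue
  measure.\<close>

definition sawtooth_sum :: "real ^ 'n \<Rightarrow> real \<Rightarrow> real" where
  "sawtooth_sum X x = (\<Sum>i\<in>UNIV. frac ((x - X $ i) / real CARD('n)))"

lemma sawtooth_sum_measurable [measurable]: "sawtooth_sum X \<in> borel_measurable borel"
  unfolding sawtooth_sum_def by measurable

lemma sawtooth_sum_periodic: "sawtooth_sum X (x + real CARD('n)) = sawtooth_sum (X :: real ^ 'n) x"
proof -
  have "frac ((x + real CARD('n) - c) / real CARD('n)) = frac ((x - c) / real CARD('n))" for c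
  proof -
    have "(x + real CARD('n) - c) / real CARD('n) = (x - c) / real CARD('n) + 1"
      by (simp add: field_simps)
    then show ?thesis using frac_1_eq[of "(x - c) / real CARD('n)"] by simp
  qed
  then show ?thesis by (simp add: sawtooth_sum_def)
qed

lemma locally_integrable_sawtooth_sum: "locally_integrable (sawtooth_sum X)"
proof (rule locally_integrable_bounded)
  show "\<bar>sawtooth_sum X x\<bar> \<le> (\<Sum>i\<in>(UNIV :: 'a set). 1)" for x
    unfolding sawtooth_sum_def by (intro order.trans[OF sum_abs sum_mono] frac_abs_le)
qed simp

lemma integral_point_measure_per:
  fixes X :: "real ^ 'n" and \<phi> :: "real \<Rightarrow> real"
  assumes "\<phi> \<in> borel_measurable borel" and S: "finite S" "\<And>i k. \<phi> (X $ i + real CARD('n) * of_int k) \<noteq> 0 \<Longrightarrow> (i, k) \<in> S"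
  shows "(\<integral>x. \<phi> x \<partial>point_measure_per X) = (\<Sum>(i, k)\<in>S. \<phi> (X $ i + real CARD('n) * of_int k))"
proof -
  let ?f = "\<lambda>(i, k). X $ i + real CARD('n) * of_int k"
  have sub: "{p. \<phi> (?f p) \<noteq> 0} \<subseteq> S" using S(2) by auto
  have "(\<integral>x. \<phi> x \<partial>point_measure_per X) = (\<integral>p. \<phi> (?f p) \<partial>count_space UNIV)"
    unfolding point_measure_per_def by (rule integral_distr[OF _ assms(1)]) simp
  also have "\<dots> = (\<Sum>p | \<phi> (?f p) \<noteq> 0. \<phi> (?f p))"
    using lebesgue_integral_count_space_finite_support[of UNIV "\<lambda>p. \<phi> (?f p)"] finite_subset[OF sub S(1)] by simp
  also have "\<dots> = (\<Sum>p\<in>S. \<phi> (?f p))"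
    using sub S(1) by (intro sum.mono_neutral_left) auto
  finally show ?thesis by (simp add: case_prod_unfold)
qed

lemma sawtooth_sum_distributional_deriv:
  "has_distributional_deriv (sawtooth_sum (X :: real ^ 'n)) lborel (point_measure_per X)"
  unfolding has_distributional_deriv_def
proof (intro allI impI)
  fix \<phi> assume \<phi>: "test_function \<phi>"
  let ?L = "real CARD('n)"
  have s: "smooth \<phi>" using \<phi> by (simp add: test_function_smooth)
  obtain R where R: "R > 0" "\<And>x. R < \<bar>x\<bar> \<Longrightarrow> \<phi> x = 0" "\<And>x. R < \<bar>x\<bar> \<Longrightarrow> deriv \<phi> x = 0"
    using test_function_bounds[OF \<phi>] by metis
  \<comment> \<open>With \<open>M\<close> larger than \<open>B\<close>, a point \<open>M\<close>
    periods away from any \<open>X $ i\<close> lies outside the support of \<open>\<phi>\<close>,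
    for all \<open>i\<close> at once.\<close>
  define B where "B = R + (\<Sum>i\<in>UNIV. \<bar>X $ i\<bar>)"
  have B: "R + \<bar>X $ i\<bar> \<le> B" for i
    unfolding B_def by (intro add_left_mono member_le_sum) auto
  obtain M :: nat where M: "B < real M" using reals_Archimedean2 by blast
  have "1 \<le> ?L" by (simp add: Suc_leI)
  then have LM: "B < ?L * real M" using M mult_right_mono[of 1 ?L "real M"] by simp
  have far: "R < \<bar>x\<bar>" if "?L * real M \<le> \<bar>x - X $ i\<bar>" for x i
    using that B[of i] LM by linarith
  have "(\<integral>x. sawtooth_sum X x * deriv \<phi> x \<partial>lborel) =
      (\<integral>x. (\<Sum>i\<in>UNIV. frac ((x - X $ i) / ?L) * deriv \<phi> x) \<partial>lborel)"
    by (simp add: sawtooth_sum_def sum_distrib_right)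
  also have "\<dots> = (\<Sum>i\<in>UNIV. \<integral>x. frac ((x - X $ i) / ?L) * deriv \<phi> x \<partial>lborel)"
    by (intro Bochner_Integration.integral_sum integrable_test_mult locally_integrable_sawtooth \<phi>)
  also have "\<dots> = (\<Sum>i\<in>UNIV. (\<Sum>k\<in>{- int M..int M}. \<phi> (X $ i + ?L * of_int k)) - (\<integral>x. \<phi> x \<partial>lborel) / ?L)"
    using far R by (intro sum.cong refl integral_sawtooth_deriv \<phi>) auto
  also have "\<dots> = (\<Sum>i\<in>UNIV. \<Sum>k\<in>{- int M..int M}. \<phi> (X $ i + ?L * of_int k)) - (\<integral>x. \<phi> x \<partial>lborel)"
    by (simp add: sum_subtractf)
  also have "(\<Sum>i\<in>UNIV. \<Sum>k\<in>{- int M..int M}. \<phi> (X $ i + ?L * of_int k)) =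
      (\<Sum>(i, k)\<in>UNIV \<times> {- int M..int M}. \<phi> (X $ i + ?L * of_int k))"
    by (simp add: sum.cartesian_product)
  also have "\<dots> = (\<integral>x. \<phi> x \<partial>point_measure_per X)"
  proof (rule integral_point_measure_per[symmetric])
    fix i k assume nz: "\<phi> (X $ i + ?L * of_int k) \<noteq> 0"
    have "\<bar>k\<bar> \<le> int M"
    proof (rule ccontr)
      assume "\<not> \<bar>k\<bar> \<le> int M"
      then have "real M \<le> \<bar>of_int k\<bar>" by linarith
      then have "?L * real M \<le> \<bar>?L * of_int k\<bar>" by (simp add: abs_mult)
      then have "R < \<bar>X $ i + ?L * of_int k\<bar>" by (intro far[of _ i]) simp
      with nz R(2) show False by blast
    qed
    then show "(i, k) \<in> UNIV \<times> {- int M..int M}" by auto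
  qed (use s smooth_measurable in auto)
  finally show "- (\<integral>x. sawtooth_sum X x * deriv \<phi> x \<partial>lborel) =
      (\<integral>x. \<phi> x \<partial>lborel) - (\<integral>x. \<phi> x \<partial>point_measure_per X)"
    by simp
qed

text \<open>The distributional derivative turns the variation into a difference of integrals of
  \<open>\<phi>\<close>; as \<open>\<phi>\<close> is bounded by 1, these cost at most the number of
  jumps in the interval plus its length.\<close>

lemma sawtooth_sum_BV_loc: "BV_loc (sawtooth_sum (X :: real ^ 'n))"
  unfolding BV_loc_def
proof (intro conjI allI locally_integrable_sawtooth_sum)
  fix a b :: real
  let ?L = "real CARD('n)"
  define S where "S = {(i, k). X $ i + ?L * of_int k \<in> {a<..<b}}"
  define B where "B = \<bar>a\<bar> + \<bar>b\<bar> + (\<Sum>i\<in>UNIV. \<bar>X $ i\<bar>)"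
  have fin: "finite S"
  proof (rule finite_subset)
    show "S \<subseteq> UNIV \<times> {\<lfloor>- B\<rfloor>..\<lceil>B\<rceil>}"
    proof
      fix p assume "p \<in> S"
      moreover obtain i k where p: "p = (i, k)" by (cases p)
      ultimately have "a < X $ i + ?L * of_int k" "X $ i + ?L * of_int k < b" by (auto simp: S_def)
      moreover have "\<bar>X $ i\<bar> \<le> (\<Sum>i\<in>UNIV. \<bar>X $ i\<bar>)" by (intro member_le_sum) auto
      ultimately have "\<bar>?L * of_int k\<bar> \<le> B" unfolding B_def by linarith
      moreover have "\<bar>of_int k\<bar> \<le> \<bar>?L * of_int k\<bar>"
        using mult_right_mono[of 1 ?L "\<bar>of_int k\<bar>"] by (simp add: abs_mult Suc_leI)
      ultimately have "\<bar>of_int k :: real\<bar> \<le> B" by linarith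
      then show "p \<in> UNIV \<times> {\<lfloor>- B\<rfloor>..\<lceil>B\<rceil>}" unfolding p by (simp, linarith)
    qed
  qed auto
  show "\<exists>C. \<forall>\<phi>. test_function \<phi> \<longrightarrow> (\<forall>x. \<bar>\<phi> x\<bar> \<le> 1) \<longrightarrow> closure {x. \<phi> x \<noteq> 0} \<subseteq> {a<..<b} \<longrightarrow>
      (\<integral>x. sawtooth_sum X x * deriv \<phi> x \<partial>lborel) \<le> C"
  proof (intro exI[of _ "real (card S) + measure lborel {a<..<b}"] allI impI)
    fix \<phi> assume \<phi>: "test_function \<phi>" and le: "\<forall>x. \<bar>\<phi> x\<bar> \<le> 1" and cl: "closure {x. \<phi> x \<noteq> 0} \<subseteq> {a<..<b}"
    have "{x. \<phi> x \<noteq> 0} \<subseteq> {a<..<b}" by (rule order.trans[OF closure_subset cl])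
    then have supp: "\<phi> x \<noteq> 0 \<Longrightarrow> x \<in> {a<..<b}" for x by blast
    have s: "smooth \<phi>" using \<phi> by (simp add: test_function_smooth)
    have "(\<integral>x. \<phi> x \<partial>point_measure_per X) = (\<Sum>(i, k)\<in>S. \<phi> (X $ i + ?L * of_int k))"
      using supp by (intro integral_point_measure_per smooth_measurable s fin) (auto simp: S_def)
    also have "\<dots> \<le> (\<Sum>(i, k)\<in>S. 1)"
      using le by (intro sum_mono) (auto simp: abs_le_iff)
    finally have 1: "(\<integral>x. \<phi> x \<partial>point_measure_per X) \<le> real (card S)" by (simp add: case_prod_unfold)
    have "- (\<integral>x. \<phi> x \<partial>lborel) = (\<integral>x. - \<phi> x \<partial>lborel)" by simp
    also have "\<dots> \<le> (\<integral>x. indicator {a<..<b} x \<partial>lborel)"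
    proof (rule integral_mono)
      show "- \<phi> x \<le> indicator {a<..<b} x" for x
        using le[rule_format, of x] supp[of x] by (cases "\<phi> x = 0") auto
    qed (use integrable_test_mult[OF locally_integrable_sawtooth_sum \<phi>] in
      \<open>cases "a \<le> b"; auto\<close>)+
    finally have 2: "- (\<integral>x. \<phi> x \<partial>lborel) \<le> measure lborel {a<..<b}" by simp
    show "(\<integral>x. sawtooth_sum X x * deriv \<phi> x \<partial>lborel) \<le> real (card S) + measure lborel {a<..<b}"
      using sawtooth_sum_distributional_deriv[of X] \<phi> 1 2 unfolding has_distributional_deriv_def by fastforce
  qed
qed

text \<open>The sum of sawtooths shows that the choice in \<open>u_of\<close> is not vacuous. The
  chosen function has the same distributional derivative, so the difference is almost everywhere
  constant.\<close>

lemma u_of_AE_sawtooth_sum: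
  obtains \<kappa> where "AE x in lborel. u_of X x = sawtooth_sum X x + \<kappa>"
proof -
  define P where "P u \<longleftrightarrow> BV_loc u \<and> (\<forall>x. u (x + real CARD('a)) = u x) \<and>
     has_distributional_deriv u lborel (point_measure_per X)" for u
  have "P (sawtooth_sum X)"
    by (simp add: P_def sawtooth_sum_BV_loc sawtooth_sum_periodic sawtooth_sum_distributional_deriv)
  moreover have "u_of X = (SOME u. P u)" by (simp add: u_of_def P_def)
  ultimately have P: "P (u_of X)" using someI[of P] by simp
  define v where "v x = u_of X x - sawtooth_sum X x" for x
  have lu: "locally_integrable (u_of X)" using P by (simp add: P_def BV_loc_def)
  have "locally_integrable v"
    unfolding v_def[abs_def] by (intro locally_integrable_diff lu locally_integrable_sawtooth_sum)
  moreover have "(\<integral>x. v x * deriv \<phi> x \<partial>lborel) = 0" if \<phi>: "test_function \<phi>" for \<phi>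
  proof -
    have "(\<integral>x. v x * deriv \<phi> x \<partial>lborel) = (\<integral>x. u_of X x * deriv \<phi> x - sawtooth_sum X x * deriv \<phi> x \<partial>lborel)"
      by (simp add: v_def algebra_simps)
    also have "\<dots> = (\<integral>x. u_of X x * deriv \<phi> x \<partial>lborel) - (\<integral>x. sawtooth_sum X x * deriv \<phi> x \<partial>lborel)"
      by (intro Bochner_Integration.integral_diff integrable_test_mult lu locally_integrable_sawtooth_sum \<phi>)
    also have "\<dots> = 0"
      using P sawtooth_sum_distributional_deriv[of X] \<phi> unfolding P_def has_distributional_deriv_def by fastforce
    finally show ?thesis .
  qed
  ultimately obtain \<kappa> where "AE x in lborel. v x = \<kappa>"
    by (rule AE_constant_of_zero_distributional_deriv)
  then have "AE x in lborel. u_of X x = sawtooth_sum X x + \<kappa>"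
    by eventually_elim (simp add: v_def)
  then show ?thesis by (rule that)
qed

section \<open>The energy as a pair interaction\<close>

text \<open>Shifting the argument by \<open>h\<close> amounts to moving the jumps by
  \<open>- h\<close>. Each cross term of the expanded square is therefore a combination of four
  autocorrelations, which is the tent.\<close>

lemma has_integral_sawtooth_sum_increment:
  fixes X :: "real ^ 'n"
  defines "L \<equiv> real CARD('n)"
  shows "((\<lambda>x. (sawtooth_sum X x - sawtooth_sum X (x + h))\<^sup>2) has_integral
    (\<Sum>i\<in>UNIV. \<Sum>j\<in>UNIV. tent L h (X $ i - X $ j))) {0..L}"
proof -
  have L: "L > 0" by (simp add: L_def)
  define a where "a i x = frac ((x - X $ i) / L)" for i x
  have "((\<lambda>x. (a i x - a i (x + h)) * (a j x - a j (x + h))) has_integral tent L h (X $ i - X $ j)) {0..L}" for i j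
  proof -
    define P where "P p q x = frac ((x - p) / L) * frac ((x - q) / L)" for p q x
    have P: "(P p q has_integral L * sawcorr ((p - q) / L)) {0..L}" for p q
      unfolding P_def[abs_def] by (rule has_integral_sawtooth_product[OF L])
    have "((\<lambda>x. P (X $ i) (X $ j) x - P (X $ i) (X $ j - h) x - P (X $ i - h) (X $ j) x + P (X $ i - h) (X $ j - h) x)
        has_integral (L * sawcorr ((X $ i - X $ j) / L) - L * sawcorr ((X $ i - (X $ j - h)) / L)
          - L * sawcorr ((X $ i - h - X $ j) / L) + L * sawcorr ((X $ i - h - (X $ j - h)) / L))) {0..L}"
      by (intro has_integral_add has_integral_diff P)
    moreover have "P (X $ i) (X $ j) x - P (X $ i) (X $ j - h) x - P (X $ i - h) (X $ j) x + P (X $ i - h) (X $ j - h) x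
        = (a i x - a i (x + h)) * (a j x - a j (x + h))" for x
      by (simp add: P_def a_def algebra_simps)
    moreover have "L * sawcorr ((X $ i - X $ j) / L) - L * sawcorr ((X $ i - (X $ j - h)) / L)
          - L * sawcorr ((X $ i - h - X $ j) / L) + L * sawcorr ((X $ i - h - (X $ j - h)) / L) = tent L h (X $ i - X $ j)"
      by (simp add: tent_def algebra_simps)
    ultimately show ?thesis by simp
  qed
  then have "((\<lambda>x. \<Sum>i\<in>UNIV. \<Sum>j\<in>UNIV. (a i x - a i (x + h)) * (a j x - a j (x + h))) has_integral
      (\<Sum>i\<in>UNIV. \<Sum>j\<in>UNIV. tent L h (X $ i - X $ j))) {0..L}"
    by (intro has_integral_sum) auto
  moreover have "(\<Sum>i\<in>UNIV. \<Sum>j\<in>UNIV. (a i x - a i (x + h)) * (a j x - a j (x + h))) =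
      (sawtooth_sum X x - sawtooth_sum X (x + h))\<^sup>2" for x
    unfolding sawtooth_sum_def L_def[symmetric] a_def[symmetric]
    by (simp add: power2_eq_square sum_product flip: sum_subtractf)
  ultimately show ?thesis by simp
qed

lemma energy_eq_sawtooth_sum:
  "energy s (X :: real ^ 'n) = ennreal (1 / 2) * (\<integral>\<^sup>+x\<in>{0..real CARD('n)}. (\<integral>\<^sup>+y.
     ennreal (\<bar>sawtooth_sum X x - sawtooth_sum X y\<bar>\<^sup>2 / \<bar>x - y\<bar> powr (1 + 2 * s)) \<partial>lborel) \<partial>lborel)"
proof -
  obtain \<kappa> where AE: "AE x in lborel. u_of X x = sawtooth_sum X x + \<kappa>"
    by (rule u_of_AE_sawtooth_sum)
  have inner: "(\<integral>\<^sup>+y. ennreal (\<bar>u_of X x - u_of X y\<bar>\<^sup>2 / \<bar>x - y\<bar> powr (1 + 2 * s)) \<partial>lborel) =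
      (\<integral>\<^sup>+y. ennreal (\<bar>sawtooth_sum X x - sawtooth_sum X y\<bar>\<^sup>2 / \<bar>x - y\<bar> powr (1 + 2 * s)) \<partial>lborel)"
    if x: "u_of X x = sawtooth_sum X x + \<kappa>" for x
  proof (rule nn_integral_cong_AE)
    show "AE y in lborel. ennreal (\<bar>u_of X x - u_of X y\<bar>\<^sup>2 / \<bar>x - y\<bar> powr (1 + 2 * s)) =
        ennreal (\<bar>sawtooth_sum X x - sawtooth_sum X y\<bar>\<^sup>2 / \<bar>x - y\<bar> powr (1 + 2 * s))"
      using AE by eventually_elim (simp add: x)
  qed
  show ?thesis
    unfolding energy_def
  proof (rule arg_cong[of _ _ "\<lambda>c. ennreal (1 / 2) * c"], rule nn_integral_cong_AE)
    show "AE x in lborel.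
        (\<integral>\<^sup>+y. ennreal (\<bar>u_of X x - u_of X y\<bar>\<^sup>2 / \<bar>x - y\<bar> powr (1 + 2 * s)) \<partial>lborel) * indicator {0..real CARD('n)} x =
        (\<integral>\<^sup>+y. ennreal (\<bar>sawtooth_sum X x - sawtooth_sum X y\<bar>\<^sup>2 / \<bar>x - y\<bar> powr (1 + 2 * s)) \<partial>lborel) * indicator {0..real CARD('n)} x"
      using AE
    proof eventually_elim
      case (elim x)
      show ?case unfolding inner[OF elim] ..
    qed
  qed
qed

text \<open>The integrand stays nonnegative until the integral over \<open>x\<close> is done, so
  Tonelli applies before finiteness is known. Only the result \<open>D h\<close> is split into
  tents, which take both signs; integrability of each quotient then justifies exchanging sums and
  integral.\<close>

lemma energy_eq_pair_energy:
  fixes X :: "real ^ 'n"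
  assumes s: "0 < s" "s < 1 / 2"
  defines "L \<equiv> real CARD('n)"
  shows "energy s X = ennreal (pair_energy (kernel s L) X)" "0 \<le> pair_energy (kernel s L) X"
proof -
  have L: "L > 0" by (simp add: L_def)
  define w where "w = sawtooth_sum X"
  have [measurable]: "w \<in> borel_measurable borel" by (simp add: w_def)
  let ?p = "\<lambda>h::real. \<bar>h\<bar> powr (1 + 2 * s)"
  define D where "D h = (\<Sum>i\<in>UNIV. \<Sum>j\<in>UNIV. tent L h (X $ i - X $ j))" for h
  have D: "((\<lambda>x. (w x - w (x + h))\<^sup>2) has_integral D h) {0..L}" for h
    unfolding w_def D_def L_def by (rule has_integral_sawtooth_sum_increment)
  have Dn: "0 \<le> D h" for h by (rule has_integral_nonneg[OF D]) simp
  have D_eq: "D h / ?p h = (\<Sum>i\<in>UNIV. \<Sum>j\<in>UNIV. tent L h (X $ i - X $ j) / ?p h)" for h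
    by (simp add: D_def sum_divide_distrib)
  have Di: "integrable lborel (\<lambda>h. D h / ?p h)"
    unfolding D_eq by (intro Bochner_Integration.integrable_sum integrable_kernel[OF s L])
  have "(\<integral>h. D h / ?p h \<partial>lborel) = (\<Sum>i\<in>UNIV. \<Sum>j\<in>UNIV. \<integral>h. tent L h (X $ i - X $ j) / ?p h \<partial>lborel)"
    unfolding D_eq
    by (subst Bochner_Integration.integral_sum, intro Bochner_Integration.integrable_sum integrable_kernel[OF s L],
      intro sum.cong refl Bochner_Integration.integral_sum integrable_kernel[OF s L])
  also have "\<dots> = 2 * pair_energy (kernel s L) X"
    by (simp add: pair_energy_def kernel_def flip: sum_divide_distrib)
  finally have int: "(\<integral>h. D h / ?p h \<partial>lborel) = 2 * pair_energy (kernel s L) X" .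
  have "0 \<le> (\<integral>h. D h / ?p h \<partial>lborel)"
    using Dn by (intro integral_nonneg_AE AE_I2) simp
  then show nonneg: "0 \<le> pair_energy (kernel s L) X" by (simp add: int)
  have inner: "(\<integral>\<^sup>+x. ennreal (\<bar>w x - w (x + h)\<bar>\<^sup>2 / ?p h) * indicator {0..L} x \<partial>lborel) = ennreal (D h / ?p h)" for h
  proof -
    define g where "g x = (if x \<in> {0..L} then (w x - w (x + h))\<^sup>2 / ?p h else 0)" for x
    have "(g has_integral D h / ?p h) UNIV"
      unfolding g_def has_integral_restrict_UNIV using D by (rule has_integral_divide)
    then have "(\<integral>\<^sup>+x. ennreal (g x) \<partial>lborel) = ennreal (D h / ?p h)"
      by (rule nn_integral_has_integral_lborel[rotated 2]) (simp_all add: g_def[abs_def])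
    moreover have "ennreal (g x) = ennreal (\<bar>w x - w (x + h)\<bar>\<^sup>2 / ?p h) * indicator {0..L} x" for x
      by (simp add: g_def)
    ultimately show ?thesis by simp
  qed
  have "(\<integral>\<^sup>+x\<in>{0..L}. (\<integral>\<^sup>+y. ennreal (\<bar>w x - w y\<bar>\<^sup>2 / ?p (x - y)) \<partial>lborel) \<partial>lborel) =
      (\<integral>\<^sup>+x. (\<integral>\<^sup>+h. ennreal (\<bar>w x - w (x + h)\<bar>\<^sup>2 / ?p h) * indicator {0..L} x \<partial>lborel) \<partial>lborel)"
  proof (rule nn_integral_cong)
    fix x
    have "(\<integral>\<^sup>+y. ennreal (\<bar>w x - w y\<bar>\<^sup>2 / ?p (x - y)) \<partial>lborel) =
        (\<integral>\<^sup>+h. ennreal (\<bar>w x - w (x + h)\<bar>\<^sup>2 / ?p h) \<partial>lborel)"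
      using nn_integral_real_affine[of "\<lambda>y. ennreal (\<bar>w x - w y\<bar>\<^sup>2 / ?p (x - y))" 1 x] by simp
    then show "(\<integral>\<^sup>+y. ennreal (\<bar>w x - w y\<bar>\<^sup>2 / ?p (x - y)) \<partial>lborel) * indicator {0..L} x =
        (\<integral>\<^sup>+h. ennreal (\<bar>w x - w (x + h)\<bar>\<^sup>2 / ?p h) * indicator {0..L} x \<partial>lborel)"
      by (simp add: nn_integral_multc)
  qed
  also have "\<dots> = (\<integral>\<^sup>+h. (\<integral>\<^sup>+x. ennreal (\<bar>w x - w (x + h)\<bar>\<^sup>2 / ?p h) * indicator {0..L} x \<partial>lborel) \<partial>lborel)"
    by (rule lborel_pair.Fubini') measurable
  also have "\<dots> = (\<integral>\<^sup>+h. ennreal (D h / ?p h) \<partial>lborel)" by (simp only: inner)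
  also have "\<dots> = ennreal (2 * pair_energy (kernel s L) X)"
    using Dn unfolding int[symmetric] by (intro nn_integral_eq_integral Di AE_I2) simp
  finally have "energy s X = ennreal (1 / 2) * ennreal (2 * pair_energy (kernel s L) X)"
    unfolding energy_eq_sawtooth_sum w_def[symmetric] L_def[symmetric] by (rule arg_cong)
  also have "\<dots> = ennreal (1 / 2 * (2 * pair_energy (kernel s L) X))"
    using nonneg by (intro ennreal_mult[symmetric]) auto
  finally show "energy s X = ennreal (pair_energy (kernel s L) X)" by simp
qed

section \<open>Critical points and minimizers\<close>

lemma torus_kernel_kernel:
  assumes "0 < s" "s < 1 / 2"
  shows "torus_kernel TYPE('n::finite) (kernel s (real CARD('n)))"
  unfolding torus_kernel_def
  by standard (use assms in \<open>auto intro: kernel_minus kernel_periodic convex_on_kernel kernel_midpoint_less\<close>)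

lemma ex_config_mod:
  fixes Z :: "real ^ 'n"
  obtains W k where "W \<in> configs" "\<And>i. W $ i = Z $ i + real CARD('n) * of_int (k i)"
proof -
  have "\<forall>i. \<exists>k::int. 0 \<le> Z $ i + real CARD('n) * of_int k \<and> Z $ i + real CARD('n) * of_int k < real CARD('n)"
    using ex_shift_interval[of "real CARD('n)"] by (metis of_nat_0_less_iff zero_less_card_finite)
  then obtain k :: "'n \<Rightarrow> int" where
    k: "\<And>i. 0 \<le> Z $ i + real CARD('n) * of_int (k i)" "\<And>i. Z $ i + real CARD('n) * of_int (k i) < real CARD('n)"
    by metis
  show ?thesis
    by (rule that[of "\<chi> i. Z $ i + real CARD('n) * of_int (k i)" k]) (use k in \<open>auto simp: configs_def\<close>)
qed

context
  fixes s :: real and F :: "real ^ 'n::finite \<Rightarrow> real" and m :: real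
  assumes s: "0 < s" "s < 1 / 2"
  defines "F \<equiv> pair_energy (kernel s (real CARD('n)))"
    and "m \<equiv> circle_kernel.min_energy (kernel s (real CARD('n))) CARD('n)"
begin

interpretation torus_kernel "kernel s (real CARD('n))" "TYPE('n)"
  by (rule torus_kernel_kernel[OF s])

text \<open>Perturbations in \<open>real ^ 'n\<close> may leave the period cell; reducing positions
  modulo the period keeps the lower bound valid there.\<close>

lemma m_le_F: "m \<le> F X"
proof -
  obtain W k where W: "W \<in> configs" "\<And>i. W $ i = X $ i + real CARD('n) * of_int (k i)"
    using ex_config_mod[of X] by blast
  have "F W = F X" unfolding F_def by (rule pair_energy_mod) (use W(2) in blast)
  then show ?thesis using min_energy_le_pair_energy[OF W(1)] by (simp add: F_def m_def)
qed

lemma equispaced_iff: "X \<in> equispaced_configs \<longleftrightarrow> X \<in> configs \<and> F X \<le> m"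
proof
  assume X: "X \<in> equispaced_configs"
  then have "X \<in> configs" by (auto simp: equispaced_configs_def regular_configs_def)
  with pair_energy_equispaced[OF X] show "X \<in> configs \<and> F X \<le> m" by (simp add: F_def m_def)
next
  assume "X \<in> configs \<and> F X \<le> m"
  then show "X \<in> equispaced_configs" using equispaced_of_minimal[of X] by (simp add: F_def m_def)
qed

lemma energy_eq_F: "energy s X = ennreal (F X)" "0 \<le> F X"
  unfolding F_def by (rule energy_eq_pair_energy[OF s])+

lemma energy_le_iff: "energy s X \<le> energy s Y \<longleftrightarrow> F X \<le> F Y"
  by (simp add: energy_eq_F)

lemma critical_point_iff: "critical_point s X \<longleftrightarrow> (F has_derivative (\<lambda>_. 0)) (at X)"
  by (simp add: critical_point_def gderiv_def energy_eq_F)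

text \<open>Minimality against a point at parameter \<open>t\<close> of the descent segment gives
  \<open>F X \<le> (1 - t) * F X + t * m\<close>, and \<open>t > 0\<close> can be divided
  out.\<close>

lemma local_minimizer_F_le:
  assumes X: "local_minimizer s X" shows "F X \<le> m"
proof -
  obtain \<epsilon> where \<epsilon>: "\<epsilon> > 0" "\<And>Y. Y \<in> configs \<Longrightarrow>
      (\<And>i. \<exists>k::int. \<bar>Y $ i - X $ i - real CARD('n) * of_int k\<bar> < \<epsilon>) \<Longrightarrow> F X \<le> F Y"
    using X unfolding local_minimizer_def energy_le_iff by blast
  obtain Y where Y: "\<And>t. 0 \<le> t \<Longrightarrow> t \<le> 1 \<Longrightarrow> F (X + t *\<^sub>R (Y - X)) \<le> (1 - t) * F X + t * m"
    using ex_descent_segment[of X] X unfolding F_def m_def local_minimizer_def by blast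
  define S where "S = (\<Sum>i\<in>UNIV. \<bar>Y $ i - X $ i\<bar>)"
  have S: "\<bar>Y $ i - X $ i\<bar> \<le> S" for i unfolding S_def by (intro member_le_sum) auto
  have "0 \<le> S" by (simp add: S_def sum_nonneg)
  \<comment> \<open>Every coordinate then moves by less than \<open>\<epsilon>\<close>; the summand
    1 also covers \<open>S = 0\<close>.\<close>
  define t where "t = min 1 (\<epsilon> / (1 + S))"
  have t: "0 < t" "t \<le> 1" using \<epsilon>(1) \<open>0 \<le> S\<close> by (auto simp: t_def)
  have ts: "t * \<bar>Y $ i - X $ i\<bar> < \<epsilon>" for i
  proof -
    have "t * \<bar>Y $ i - X $ i\<bar> < t * (1 + S)" using t S[of i] by (intro mult_strict_left_mono) auto
    also have "\<dots> \<le> (\<epsilon> / (1 + S)) * (1 + S)"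
      using \<open>0 \<le> S\<close> by (intro mult_right_mono) (auto simp: t_def)
    also have "\<dots> = \<epsilon>" using \<open>0 \<le> S\<close> by simp
    finally show ?thesis .
  qed
  \<comment> \<open>Neighbourhoods are those of the torus, so returning \<open>Z\<close> to the
    period cell costs no distance.\<close>
  define Z where "Z = X + t *\<^sub>R (Y - X)"
  obtain W k where W: "W \<in> configs" "\<And>i. W $ i = Z $ i + real CARD('n) * of_int (k i)"
    using ex_config_mod[of Z] by blast
  have "F X \<le> F W"
  proof (rule \<epsilon>(2)[OF W(1)])
    fix i
    have "W $ i - X $ i - real CARD('n) * of_int (k i) = t * (Y $ i - X $ i)"
      by (simp add: W(2) Z_def)
    then show "\<exists>k::int. \<bar>W $ i - X $ i - real CARD('n) * of_int k\<bar> < \<epsilon>"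
      using ts[of i] t by (intro exI[of _ "k i"]) (simp add: abs_mult)
  qed
  also have "F W = F Z" unfolding F_def by (rule pair_energy_mod) (use W(2) in blast)
  also have "F Z \<le> (1 - t) * F X + t * m" unfolding Z_def using t by (intro Y) auto
  finally have "t * F X \<le> t * m" by (simp add: algebra_simps)
  then show ?thesis using t by simp
qed

text \<open>A vanishing gradient makes the right derivative along the descent segment 0, whereas the
  chord bound keeps all difference quotients at most \<open>m - F X\<close>.\<close>

lemma critical_point_F_le:
  assumes X: "X \<in> configs" and crit: "critical_point s X" shows "F X \<le> m"
proof (rule ccontr)
  assume "\<not> F X \<le> m"
  obtain Y where Y: "\<And>t. 0 \<le> t \<Longrightarrow> t \<le> 1 \<Longrightarrow> F (X + t *\<^sub>R (Y - X)) \<le> (1 - t) * F X + t * m"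
    using ex_descent_segment[OF X] unfolding F_def m_def by blast
  have "((\<lambda>t. X + t *\<^sub>R (Y - X)) has_derivative (\<lambda>t. t *\<^sub>R (Y - X))) (at 0)"
    by (auto intro!: derivative_eq_intros)
  then have "((\<lambda>t. F (X + t *\<^sub>R (Y - X))) has_derivative (\<lambda>t. 0)) (at 0)"
    using crit unfolding critical_point_iff
    by (intro has_derivative_compose[of "\<lambda>t. X + t *\<^sub>R (Y - X)" _ _ _ F "\<lambda>_. 0"]) auto
  then have "((\<lambda>t. F (X + t *\<^sub>R (Y - X))) has_real_derivative 0) (at 0)"
    by (simp add: has_field_derivative_def lambda_zero)
  then have "((\<lambda>t. (F (X + t *\<^sub>R (Y - X)) - F X) / t) \<longlongrightarrow> 0) (at 0)"
    by (simp add: DERIV_def)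
  then have "((\<lambda>t. (F (X + t *\<^sub>R (Y - X)) - F X) / t) \<longlongrightarrow> 0) (at_right 0)"
    by (simp add: filterlim_at_split)
  moreover have "\<forall>\<^sub>F t in at_right 0. (F (X + t *\<^sub>R (Y - X)) - F X) / t \<le> m - F X"
    unfolding eventually_at_right_field
  proof (intro exI[of _ 1] conjI allI impI)
    fix t :: real assume "0 < t" "t < 1"
    then have "F (X + t *\<^sub>R (Y - X)) - F X \<le> t * (m - F X)"
      using Y[of t] by (simp add: algebra_simps)
    then show "(F (X + t *\<^sub>R (Y - X)) - F X) / t \<le> m - F X"
      using \<open>0 < t\<close> by (simp add: field_simps)
  qed simp
  ultimately have "0 \<le> m - F X" by (rule tendsto_upperbound) simp
  with \<open>\<not> F X \<le> m\<close> show False by simp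
qed

text \<open>
  \<open>F\<close> is squeezed at a minimum between its minimal value and its symmetric second difference,
  which is of smaller than linear order.
\<close>

lemma equispaced_critical:
  assumes X: "X \<in> (equispaced_configs :: (real ^ 'n) set)" shows "critical_point s X"
proof -
  let ?K = "kernel s (real CARD('n))"
  define S where "S d t = ?K (d + t) + ?K (d - t) - 2 * ?K d" for d t
  define G where "G v = (\<Sum>i\<in>UNIV. \<Sum>j\<in>UNIV. S (X $ i - X $ j) (v $ i - v $ j))" for v :: "real ^ 'n"
  have S_minus: "S (- d) t = S d t" for d t
    using K_minus[of "d + t"] K_minus[of "d - t"] K_minus[of d] by (simp add: S_def)
  have "((\<lambda>v. S (X $ i - X $ j) (v $ i - v $ j)) has_derivative (\<lambda>_. 0)) (at (0 :: real ^ 'n))" for i j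
  \<comment> \<open>Diagonal terms see no displacement. Off the diagonal the two points are distinct
    and in one period, which puts their distance strictly between 0 and the period, away from the
    corner of the kernel.\<close>
  proof (cases "i = j")
    case False
    have "inj (\<lambda>i. X $ i)" "X \<in> configs"
      using X by (auto simp: equispaced_configs_def regular_configs_def)
    then have "X $ i \<noteq> X $ j" "0 \<le> X $ i" "X $ i < real CARD('n)" "0 \<le> X $ j" "X $ j < real CARD('n)"
      using False by (auto simp: inj_def configs_def)
    then have "(S \<bar>X $ i - X $ j\<bar> has_real_derivative 0) (at 0)"
      unfolding S_def[abs_def] by (intro kernel_second_difference_has_derivative_0[OF s]) auto
    moreover have "S \<bar>X $ i - X $ j\<bar> = S (X $ i - X $ j)"
      using S_minus[of "X $ i - X $ j"] by (cases "X $ i \<ge> X $ j") (auto simp: fun_eq_iff abs_if S_minus)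
    ultimately have "(S (X $ i - X $ j) has_derivative (\<lambda>_. 0)) (at 0)"
      by (simp add: has_field_derivative_def lambda_zero)
    moreover have "((\<lambda>v. v $ i - v $ j) has_derivative (\<lambda>v. v $ i - v $ j)) (at (0 :: real ^ 'n))"
      by (intro bounded_linear_imp_has_derivative bounded_linear_sub bounded_linear_vec_nth)
    ultimately show ?thesis
      by (intro has_derivative_compose[of "\<lambda>v. v $ i - v $ j" _ _ _ "S (X $ i - X $ j)" "\<lambda>_. 0"]) auto
  qed (simp add: S_def)
  then have "(G has_derivative (\<lambda>_. \<Sum>i\<in>(UNIV :: 'n set). \<Sum>j\<in>(UNIV :: 'n set). 0)) (at 0)"
    unfolding G_def[abs_def] by (intro has_derivative_sum)
  then have G: "(\<lambda>h. norm (G h) / norm h) \<midarrow>0\<rightarrow> 0"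
    by (simp add: has_derivative_at G_def S_def)
  have FG: "F (X + v) + F (X - v) - 2 * F X = G v" for v
    unfolding F_def pair_energy_def G_def S_def
    by (simp add: sum.distrib sum_subtractf sum_distrib_left algebra_simps)
  have FX: "F X \<le> F Y" for Y
    using X m_le_F[of Y] unfolding equispaced_iff by linarith
  have "(\<lambda>h. norm (F (X + h) - F X - 0) / norm h) \<midarrow>0\<rightarrow> 0"
  proof (rule tendsto_sandwich[OF _ _ tendsto_const G])
    show "\<forall>\<^sub>F h in at 0. norm (F (X + h) - F X - 0) / norm h \<le> norm (G h) / norm h"
    proof (intro always_eventually allI divide_right_mono)
      fix h
      \<comment> \<open>The two increments \<open>F (X + h) - F X\<close> and
        \<open>F (X - h) - F X\<close> are nonnegative and add up to \<open>G h\<close>.\<close>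
      show "norm (F (X + h) - F X - 0) \<le> norm (G h)"
        using FG[of h] FX[of "X + h"] FX[of "X - h"] by simp
    qed simp
  qed simp
  then show ?thesis unfolding critical_point_iff has_derivative_at by simp
qed

lemma critical_local_global_iff_equispaced:
  "{X \<in> regular_configs. critical_point s X} = (equispaced_configs :: (real ^ 'n) set)"
  "equispaced_configs = {X :: real ^ 'n. local_minimizer s X}"
  "equispaced_configs = {X :: real ^ 'n. global_minimizer s X}"
proof -
  show "{X \<in> regular_configs. critical_point s X} = (equispaced_configs :: (real ^ 'n) set)"
  proof (intro subset_antisym subsetI)
    fix X :: "real ^ 'n" assume "X \<in> {X \<in> regular_configs. critical_point s X}"
    then have "X \<in> configs" "critical_point s X" by (auto simp: regular_configs_def)
    then show "X \<in> equispaced_configs" using critical_point_F_le by (simp add: equispaced_iff)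
  next
    fix X :: "real ^ 'n" assume X: "X \<in> equispaced_configs"
    then have "X \<in> regular_configs" by (simp add: equispaced_configs_def)
    with equispaced_critical[OF X] show "X \<in> {X \<in> regular_configs. critical_point s X}" by simp
  qed
  \<comment> \<open>A cycle of three inclusions, from equispaced to global to local and back, gives
    both equalities.\<close>
  have "equispaced_configs \<subseteq> {X :: real ^ 'n. global_minimizer s X}"
  proof
    fix X :: "real ^ 'n" assume "X \<in> equispaced_configs"
    then have "X \<in> configs" "F X \<le> F Y" for Y
      using m_le_F[of Y] unfolding equispaced_iff by auto
    then show "X \<in> {X. global_minimizer s X}" by (simp add: global_minimizer_def energy_le_iff)
  qed
  moreover have "{X :: real ^ 'n. global_minimizer s X} \<subseteq> {X. local_minimizer s X}"
    by (auto simp: global_minimizer_def local_minimizer_def intro!: exI[of _ 1])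
  moreover have "{X :: real ^ 'n. local_minimizer s X} \<subseteq> equispaced_configs"
    using local_minimizer_F_le by (auto simp: equispaced_iff) (simp add: local_minimizer_def)
  ultimately show "equispaced_configs = {X :: real ^ 'n. local_minimizer s X}"
    "equispaced_configs = {X :: real ^ 'n. global_minimizer s X}" by auto
qed

end

theorem theorem3p1:
  fixes s :: real
  assumes "0 < s" and "s < 1 / 2"
  shows "{X \<in> regular_configs. critical_point s X} = (equispaced_configs :: (real ^ 'n) set) \<and>
    (equispaced_configs :: (real ^ 'n) set) = {X. local_minimizer s X} \<and>
    (equispaced_configs :: (real ^ 'n) set) = {X. global_minimizer s X}"
  using critical_local_global_iff_equispaced[OF assms] by blast

end
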